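(* The smallest element of $\mathcal{B}_{\aleph_0}$ strictly greater than $\frac{1+\sqrt5}{2}$ is $q_{\aleph_0}\approx 1.64541$, the root in $(1,2)$ of the equation $x^6=x^4+x^3+2x^2+x+1$.
   Context: For $q\in(1,2)$ and $x\in I_q:=[0,\frac1{q-1}]$, a $q$-expansion of $x$ is a sequence $(\epsilon_i)_{i=1}^\infty\in\{0,1\}^{\mathbb N}$ with $x=\sum_{i=1}^\infty \epsilon_i q^{-i}$; $\Sigma_q(x)$ denotes the set of all $q$-expansions of $x$. The set $\mathcal{B}_{\aleph_0}$ is defined by $$\mathcal{B}_{\aleph_0}:=\Big\{q\in(1,2) : \text{there exists } x\in\big(0,\tfrac1{q-1}\big) \text{ with } \operatorname{card}\Sigma_q(x)=\aleph_0\Big\}.$$ *)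

theory Defs
  imports "HOL-Analysis.Analysis"
begin

text \<open>Sequences are indexed from 0, so \<open>\<epsilon> i\<close> is the digit \<open>\<epsilon>\<^sub>i\<^sub>+\<^sub>1\<close> of weight \<open>q\<^sup>-\<^sup>(\<^sup>i\<^sup>+\<^sup>1\<^sup>)\<close>.\<close>

definition q_expansions :: "real \<Rightarrow> real \<Rightarrow> (nat \<Rightarrow> nat) set" where
  "q_expansions q x =
     {\<epsilon>. (\<forall>i. \<epsilon> i \<in> {0, 1}) \<and> (\<lambda>i. real (\<epsilon> i) / q ^ Suc i) sums x}"

definition B_aleph0 :: "real set" where
  "B_aleph0 =
     {q \<in> {1<..<2}. \<exists>x \<in> {0<..<1 / (q - 1)}. q_expansions q x \<approx> (UNIV :: nat set)}"

end

theory Submission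
  imports Defs
begin

text \<open>
  Write \<open>T\<^sub>d y = q y - d\<close> for \<open>d \<in> {0, 1}\<close> and \<open>I = [0, 1/(q-1)]\<close>. A 0-1 sequence expands \<open>x\<close> iff the
  orbit of \<open>x\<close> under the maps that it selects stays in \<open>I\<close> (\<open>expansion_iff_orb\<close>). There is a free
  choice of digit exactly at the points of the switch interval \<open>S = [1/q, 1/(q(q-1))]\<close>; a point is
  \<^emph>\<open>multiple\<close> if it has two expansions, and \<^emph>\<open>simple\<close> if it has exactly one. The map
  \<open>y \<mapsto> 1/(q-1) - y\<close> complements all digits and halves the number of cases.

  \<^emph>\<open>No base strictly between the golden ratio and the root.\<close> If every multiple point
  has a descendant in \<open>S\<close> both of whose children are multiple, then the tree of expansions of a
  multiple point contains a full binary tree, so that a point of \<open>I\<close> has one expansion or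
  uncountably many (\<open>uncountable_if_splitting\<close>). Otherwise there is a set \<open>D\<close> of points that
  meets \<open>S\<close>, is closed under taking children and under reflection, and in which every point of
  \<open>S\<close> has a simple child. For \<open>q\<close> above the golden ratio and not too large, a simple point \<open>u\<close>
  with \<open>u \<le> 1/(q-1) - 1\<close> has the form \<open>t/(q\<^sup>2-1)\<close>, where \<open>t = 0\<close> or \<open>t = q\<^sup>-\<^sup>j\<close> with \<open>j \<ge> 1\<close>: unless
  \<open>u = 0\<close>, its orbit must end in the cycle of \<open>(10)\<^sup>\<infinity>\<close> (\<open>simple_le_imp_inv_power\<close>). So \<open>D\<close> contains,
  up to reflection, a point \<open>1 + t/(q\<^sup>2-1)\<close>, the sibling of such a simple point. From there the
  orbit is forced until it next meets \<open>S\<close>, where again one child is simple. This is an algebraic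
  equation between \<open>t\<close> and the parameter \<open>t'\<close> of the next sibling. For \<open>t \<le> q\<^sup>-\<^sup>3\<close> it says
  \<open>t' = q\<^sup>2 t + (q\<^sup>2-q-1)(q\<^sup>2-1)\<close>, unless \<open>q\<^sup>2 t + t' = 1+q\<^sup>2+q\<^sup>3-q\<^sup>4\<close>. The second equation has no
  solution here, because \<open>q\<^sup>-\<^sup>1 + q\<^sup>-\<^sup>3\<close> is too small and \<open>q\<^sup>-\<^sup>1 + q\<^sup>-\<^sup>2\<close> too large; it is exactly at
  the root of the sextic that \<open>q\<^sup>-\<^sup>1 + q\<^sup>-\<^sup>3\<close> reaches the right-hand side (\<open>inv_powers_sum\<close>). By
  the first equation \<open>t' > q\<^sup>2 t\<close>, so the exponent \<open>j\<close> decreases until \<open>t\<close> is \<open>q\<^sup>-\<^sup>1\<close> or \<open>q\<^sup>-\<^sup>2\<close>, and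
  from these two values the next but one parameter would lie strictly between two consecutive
  powers of \<open>1/q\<close> (\<open>sibling_between_dead\<close>). So there is no such \<open>D\<close>.

  \<^emph>\<open>The root.\<close> There the exceptional equation has the solution \<open>t = t' = q\<^sup>-\<^sup>3\<close>. The orbit of the
  point \<open>h = 1 + q\<^sup>-\<^sup>3/(q\<^sup>2-1)\<close> is forced to \<open>q h - 1 \<in> S\<close>, whose child under \<open>T\<^sub>0\<close> is simple and
  whose child under \<open>T\<^sub>1\<close> is the reflection of \<open>h\<close>. So an expansion of \<open>h\<close> is either one particular
  sequence beginning with \<open>10\<close>, or \<open>11\<close> followed by the complement of an expansion of \<open>h\<close>
  (\<open>hub_expansions\<close>). Such a self-similar set is infinite, and it is countable because an element
  is determined by the finite or infinite number of times that the second alternative is taken.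
\<close>

section \<open>Expansions as orbits\<close>

locale base =
  fixes q :: real
  assumes q_gt_1: "1 < q" and q_lt_2: "q < 2"
begin

definition top_end :: real where "top_end = 1 / (q - 1)"

primrec orb :: "real \<Rightarrow> (nat \<Rightarrow> nat) \<Rightarrow> nat \<Rightarrow> real" where
  "orb x \<epsilon> 0 = x"
| "orb x \<epsilon> (Suc n) = q * orb x \<epsilon> n - real (\<epsilon> n)"

definition multiple :: "real \<Rightarrow> bool" where
  "multiple x \<longleftrightarrow> (\<exists>\<epsilon> \<in> q_expansions q x. \<exists>\<eta> \<in> q_expansions q x. \<epsilon> \<noteq> \<eta>)"

text \<open>These are the points at which both digits keep the orbit in range; see \<open>switch_children\<close>.\<close>
definition switch :: "real set" where
  "switch = {1 / q .. top_end / q}"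

lemma top_end_fixed: "q * top_end = top_end + 1"
  using q_gt_1 by (simp add: top_end_def field_simps)

lemma top_end_gt_1: "1 < top_end"
  using q_gt_1 q_lt_2 by (simp add: top_end_def field_simps)

lemma orb_add: "orb x \<epsilon> (m + n) = orb (orb x \<epsilon> m) (\<lambda>i. \<epsilon> (m + i)) n"
  by (induction n) auto

lemma orb_cong: "(\<And>i. i < n \<Longrightarrow> \<epsilon> i = \<eta> i) \<Longrightarrow> orb x \<epsilon> n = orb x \<eta> n"
  by (induction n) auto

lemma expansion_range:
  assumes "\<epsilon> \<in> q_expansions q x"
  shows "x \<in> {0..top_end}"
proof -
  have d: "\<epsilon> i \<le> 1" for i
  proof -
    have "\<epsilon> i \<in> {0, 1}" using assms by (simp add: q_expansions_def)
    then show ?thesis by auto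
  qed
  have s: "(\<lambda>i. real (\<epsilon> i) / q ^ Suc i) sums x"
    using assms by (simp add: q_expansions_def)
  have "(\<lambda>i. (1/q) * (1/q) ^ i) sums ((1/q) * (1 / (1 - 1/q)))"
    using q_gt_1 by (intro sums_mult geometric_sums) simp
  moreover have "(1/q) * (1 / (1 - 1/q)) = top_end"
    using q_gt_1 by (simp add: top_end_def field_simps)
  ultimately have g: "(\<lambda>i. 1 / q ^ Suc i) sums top_end"
    by (simp add: power_divide)
  have "x \<le> top_end"
    by (rule sums_le[OF _ s g]) (use d q_gt_1 in \<open>auto intro!: divide_right_mono\<close>)
  moreover have "0 \<le> x"
    by (rule sums_le[OF _ sums_zero s]) (use q_gt_1 in auto)
  ultimately show ?thesis by simp
qed

lemma expansion_shift:
  assumes "\<epsilon> \<in> q_expansions q x"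
  shows "(\<lambda>i. \<epsilon> (Suc i)) \<in> q_expansions q (q * x - real (\<epsilon> 0))"
proof -
  have "(\<lambda>i. real (\<epsilon> i) / q ^ Suc i) sums x"
    using assms by (simp add: q_expansions_def)
  then have "(\<lambda>i. real (\<epsilon> (Suc i)) / q ^ Suc (Suc i)) sums (x - real (\<epsilon> 0) / q)"
    by (subst sums_Suc_iff) simp
  then have "(\<lambda>i. q * (real (\<epsilon> (Suc i)) / q ^ Suc (Suc i))) sums (q * (x - real (\<epsilon> 0) / q))"
    by (rule sums_mult)
  then show ?thesis
    using q_gt_1 assms by (simp add: q_expansions_def algebra_simps)
qed

text \<open>
  After \<open>n\<close> digits the error of the partial sum is \<open>orb x \<epsilon> n / q ^ n\<close>. A bounded orbit therefore
  forces convergence to \<open>x\<close>. Conversely, an orbit point is the sum of the series of remaining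
  digits, and such a series has a value in \<open>{0..top_end}\<close>.
\<close>
lemma expansion_iff_orb:
  "\<epsilon> \<in> q_expansions q x \<longleftrightarrow> (\<forall>i. \<epsilon> i \<in> {0, 1}) \<and> (\<forall>n. orb x \<epsilon> n \<in> {0..top_end})"
proof
  assume A: "\<epsilon> \<in> q_expansions q x"
  have "(\<lambda>i. \<epsilon> (n + i)) \<in> q_expansions q (orb x \<epsilon> n)" for n
  proof (induction n)
    case 0
    show ?case using A by simp
  next
    case (Suc n)
    show ?case using expansion_shift[OF Suc] by simp
  qed
  then have "orb x \<epsilon> n \<in> {0..top_end}" for n
    using expansion_range by blast
  with A show "(\<forall>i. \<epsilon> i \<in> {0, 1}) \<and> (\<forall>n. orb x \<epsilon> n \<in> {0..top_end})"
    by (simp add: q_expansions_def)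
next
  assume A: "(\<forall>i. \<epsilon> i \<in> {0, 1}) \<and> (\<forall>n. orb x \<epsilon> n \<in> {0..top_end})"
  have partial: "(\<Sum>i<n. real (\<epsilon> i) / q ^ Suc i) = x - orb x \<epsilon> n * (1 / q) ^ n" for n
  proof (induction n)
    case 0
    show ?case by simp
  next
    case (Suc n)
    have "real (\<epsilon> n) / q ^ Suc n = real (\<epsilon> n) * (1 / q) ^ n / q"
      by (simp add: power_divide)
    moreover have "orb x \<epsilon> (Suc n) * (1 / q) ^ Suc n = (orb x \<epsilon> n - real (\<epsilon> n) / q) * (1 / q) ^ n"
      using q_gt_1 by (simp add: field_simps)
    ultimately show ?case using Suc by (simp add: algebra_simps)
  qed
  have "(\<lambda>n. orb x \<epsilon> n * (1 / q) ^ n) \<longlonglongrightarrow> 0"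
  proof (rule Lim_null_comparison)
    show "\<forall>\<^sub>F n in sequentially. norm (orb x \<epsilon> n * (1 / q) ^ n) \<le> top_end * (1 / q) ^ n"
      using A q_gt_1 by (auto simp: abs_mult intro!: always_eventually mult_right_mono)
    have "(\<lambda>n. (1 / q) ^ n) \<longlonglongrightarrow> 0"
      using q_gt_1 by (intro LIMSEQ_power_zero) simp
    then show "(\<lambda>n. top_end * (1 / q) ^ n) \<longlonglongrightarrow> 0"
      by (rule tendsto_mult_right_zero)
  qed
  then have "(\<lambda>n. x - orb x \<epsilon> n * (1 / q) ^ n) \<longlonglongrightarrow> x - 0"
    by (intro tendsto_diff tendsto_const)
  then have "(\<lambda>i. real (\<epsilon> i) / q ^ Suc i) sums x"
    unfolding sums_def partial by simp
  with A show "\<epsilon> \<in> q_expansions q x"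
    by (simp add: q_expansions_def)
qed

text \<open>The greedy choice, digit \<open>1\<close> whenever it is possible, never leaves the range.\<close>
lemma expansion_exists:
  assumes "x \<in> {0..top_end}"
  shows "\<exists>\<epsilon>. \<epsilon> \<in> q_expansions q x"
proof -
  define g where "g = rec_nat x (\<lambda>_ y. q * y - (if 1 / q \<le> y then 1 else 0))"
  define \<epsilon> where "\<epsilon> n = (if 1 / q \<le> g n then 1 else 0 :: nat)" for n
  have g: "g n \<in> {0..top_end}" for n
  proof (induction n)
    case 0
    then show ?case using assms by (simp add: g_def)
  next
    case (Suc n)
    have "q * g n \<le> q * top_end"
      using Suc q_gt_1 by (intro mult_left_mono) auto
    then have "q * g n - 1 \<le> top_end" using top_end_fixed by simp
    moreover have "1 \<le> q * g n" if "1 / q \<le> g n"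
      using that q_gt_1 by (simp add: field_simps)
    moreover have "q * g n \<le> 1" if "\<not> 1 / q \<le> g n"
      using that q_gt_1 by (simp add: field_simps)
    ultimately show ?case
      using Suc q_gt_1 top_end_gt_1 by (auto simp: g_def)
  qed
  have "orb x \<epsilon> n = g n" for n
    by (induction n) (auto simp: g_def \<epsilon>_def)
  with g have "\<epsilon> \<in> q_expansions q x"
    by (auto simp: expansion_iff_orb \<epsilon>_def)
  then show ?thesis by blast
qed

lemma expansion_Cons:
  "case_nat d \<epsilon> \<in> q_expansions q x \<longleftrightarrow> d \<in> {0, 1} \<and> \<epsilon> \<in> q_expansions q (q * x - real d)"
proof -
  have o: "orb x (case_nat d \<epsilon>) (Suc n) = orb (q * x - real d) \<epsilon> n" for n
    using orb_add[of x "case_nat d \<epsilon>" 1 n] by simp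
  have "x \<in> {0..top_end}" if "q * x - real d \<in> {0..top_end}" "d \<in> {0, 1}"
  proof -
    have "0 \<le> q * x" "q * x \<le> q * top_end"
      using that top_end_fixed by auto
    then show ?thesis using q_gt_1 by (auto simp: zero_le_mult_iff)
  qed
  then have "(\<forall>n. orb x (case_nat d \<epsilon>) n \<in> {0..top_end}) \<longleftrightarrow>
        (\<forall>n. orb (q * x - real d) \<epsilon> n \<in> {0..top_end})" if "d \<in> {0, 1}"
    using o that by (metis nat.exhaust orb.simps(1))
  moreover have "(\<forall>i. case_nat d \<epsilon> i \<in> {0, 1}) \<longleftrightarrow> d \<in> {0,1} \<and> (\<forall>i. \<epsilon> i \<in> {0, 1})"
    by (auto split: nat.splits)
  ultimately show ?thesis
    unfolding expansion_iff_orb by (cases "d \<in> {0, 1}") simp_all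
qed

lemma expansion_cases:
  assumes "\<epsilon> \<in> q_expansions q x"
  obtains d \<eta> where "\<epsilon> = case_nat d \<eta>" "d \<in> {0, 1}" "\<eta> \<in> q_expansions q (q * x - real d)"
proof -
  have "\<epsilon> = case_nat (\<epsilon> 0) (\<lambda>i. \<epsilon> (Suc i))"
    by (auto split: nat.splits)
  then show thesis
    using that assms expansion_Cons by metis
qed

lemma expansion_splice:
  assumes "\<epsilon> \<in> q_expansions q x" and "\<eta> \<in> q_expansions q (orb x \<epsilon> n)"
  shows "\<exists>\<zeta> \<in> q_expansions q x. (\<forall>i<n. \<zeta> i = \<epsilon> i) \<and> (\<forall>i. \<zeta> (n + i) = \<eta> i)"
proof
  define \<zeta> where "\<zeta> i = (if i < n then \<epsilon> i else \<eta> (i - n))" for i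
  show "(\<forall>i<n. \<zeta> i = \<epsilon> i) \<and> (\<forall>i. \<zeta> (n + i) = \<eta> i)"
    by (simp add: \<zeta>_def)
  have "orb x \<zeta> m \<in> {0..top_end}" for m
  proof (cases "m \<le> n")
    case True
    then have "orb x \<zeta> m = orb x \<epsilon> m" by (intro orb_cong) (simp add: \<zeta>_def)
    then show ?thesis using assms(1) by (simp add: expansion_iff_orb)
  next
    case False
    have "orb x \<zeta> n = orb x \<epsilon> n" by (intro orb_cong) (simp add: \<zeta>_def)
    then have "orb x \<zeta> (n + (m - n)) = orb (orb x \<epsilon> n) \<eta> (m - n)"
      unfolding orb_add by (simp add: \<zeta>_def)
    then show ?thesis using False assms(2) by (simp add: expansion_iff_orb)
  qed
  then show "\<zeta> \<in> q_expansions q x"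
    using assms by (auto simp: expansion_iff_orb \<zeta>_def)
qed

lemma expansion_complement:
  assumes "\<epsilon> \<in> q_expansions q x"
  shows "(\<lambda>i. 1 - \<epsilon> i) \<in> q_expansions q (top_end - x)"
proof -
  have d: "real (1 - \<epsilon> i) = 1 - real (\<epsilon> i)" for i
  proof -
    have "\<epsilon> i \<in> {0, 1}" using assms unfolding expansion_iff_orb by blast
    then show ?thesis by auto
  qed
  have "orb (top_end - x) (\<lambda>i. 1 - \<epsilon> i) n = top_end - orb x \<epsilon> n" for n
  proof (induction n)
    case (Suc n)
    then show ?case using top_end_fixed by (simp add: d right_diff_distrib del: One_nat_def)
  qed simp
  then show ?thesis
    using assms by (auto simp: expansion_iff_orb)
qed

lemma multiple_reflect: "multiple x \<Longrightarrow> multiple (top_end - x)"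
proof -
  assume "multiple x"
  then obtain \<epsilon> \<eta> where A: "\<epsilon> \<in> q_expansions q x" "\<eta> \<in> q_expansions q x" "\<epsilon> \<noteq> \<eta>"
    by (auto simp: multiple_def)
  then obtain i where i: "\<epsilon> i \<noteq> \<eta> i" by blast
  have "\<epsilon> i \<in> {0, 1}" "\<eta> i \<in> {0, 1}"
    using A unfolding expansion_iff_orb by blast+
  with i have "1 - \<epsilon> i \<noteq> 1 - \<eta> i" by auto
  then have "(\<lambda>i. 1 - \<epsilon> i) \<noteq> (\<lambda>i. 1 - \<eta> i)" by meson
  then show ?thesis
    using expansion_complement A unfolding multiple_def by blast
qed

lemma multiple_range: "multiple x \<Longrightarrow> x \<in> {0..top_end}"
  using expansion_range by (auto simp: multiple_def)

lemma multiple_parent: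
  assumes "multiple (q * x - real d)" and "d \<in> {0, 1}"
  shows "multiple x"
proof -
  obtain \<epsilon> \<eta> where A: "\<epsilon> \<in> q_expansions q (q * x - real d)" "\<eta> \<in> q_expansions q (q * x - real d)" "\<epsilon> \<noteq> \<eta>"
    using assms by (auto simp: multiple_def)
  then have "case_nat d \<epsilon> \<noteq> case_nat d \<eta>"
    by (metis ext old.nat.simps(5))
  then show ?thesis
    using A assms(2) unfolding multiple_def by (metis expansion_Cons)
qed

lemma switch_children:
  "y \<in> switch \<longleftrightarrow> q * y \<in> {0..top_end} \<and> q * y - 1 \<in> {0..top_end}"
  using q_gt_1 top_end_gt_1 by (auto simp: switch_def field_simps)

lemma switch_imp_multiple:
  assumes "y \<in> switch"
  shows "multiple y"
proof -
  obtain \<epsilon> \<eta> where "\<epsilon> \<in> q_expansions q (q * y - real 0)" "\<eta> \<in> q_expansions q (q * y - real 1)"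
    using assms expansion_exists unfolding switch_children by fastforce
  then have "case_nat 0 \<epsilon> \<in> q_expansions q y" "case_nat 1 \<eta> \<in> q_expansions q y"
    by (auto simp: expansion_Cons)
  moreover have "case_nat 0 \<epsilon> \<noteq> case_nat 1 \<eta>"
    by (metis old.nat.simps(4) zero_neq_one)
  ultimately show ?thesis unfolding multiple_def by blast
qed

text \<open>At the first place where two expansions of \<open>x\<close> differ, both digits are possible.\<close>
lemma multiple_imp_switch:
  assumes "multiple x"
  shows "\<exists>\<epsilon> \<in> q_expansions q x. \<exists>n. orb x \<epsilon> n \<in> switch"
proof -
  obtain \<epsilon> \<eta> where A: "\<epsilon> \<in> q_expansions q x" "\<eta> \<in> q_expansions q x" "\<epsilon> \<noteq> \<eta>"
    using assms by (auto simp: multiple_def)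
  define n where "n = (LEAST n. \<epsilon> n \<noteq> \<eta> n)"
  have ne: "\<epsilon> n \<noteq> \<eta> n"
  proof -
    obtain i where "\<epsilon> i \<noteq> \<eta> i" using A(3) by blast
    then show ?thesis unfolding n_def by (rule LeastI)
  qed
  have "\<epsilon> i = \<eta> i" if "i < n" for i
    using not_less_Least that unfolding n_def by blast
  then have o: "orb x \<epsilon> n = orb x \<eta> n" by (rule orb_cong)
  have "orb x \<epsilon> (Suc n) \<in> {0..top_end}" "orb x \<eta> (Suc n) \<in> {0..top_end}" "\<epsilon> n \<in> {0, 1}" "\<eta> n \<in> {0, 1}"
    using A unfolding expansion_iff_orb by blast+
  then have "orb x \<epsilon> n \<in> switch"
    using ne o unfolding switch_children by auto
  then show ?thesis using A(1) by blast
qed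

text \<open>
  A diagonal argument: given a list \<open>e\<close> of expansions, extend a prefix that leads to a multiple
  point to a longer prefix that leads to a multiple point and disagrees with \<open>e k\<close>. This is always
  possible, as one can go on to a point with two multiple children and there choose the digit that
  \<open>e k\<close> does not have. The limit of these prefixes is an expansion outside the list.
\<close>
lemma uncountable_if_splitting:
  assumes split: "\<And>x. multiple x \<Longrightarrow>
      \<exists>\<epsilon> \<in> q_expansions q x. \<exists>n. multiple (q * orb x \<epsilon> n) \<and> multiple (q * orb x \<epsilon> n - 1)"
    and "multiple x"
  shows "uncountable (q_expansions q x)"
proof
  assume "countable (q_expansions q x)"
  then obtain e where e: "q_expansions q x \<subseteq> range (e :: nat \<Rightarrow> _)"
    by (metis countable_as_injective_image_subset image_mono subset_UNIV)
  \<comment> \<open>A prefix is represented by its length together with some expansion that extends it.\<close>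
  let ?P = "\<lambda>(n, f). f \<in> q_expansions q x \<and> multiple (orb x f n)"
  let ?R = "\<lambda>k (n, f) (m, g). n < m \<and> (\<forall>i<n. g i = f i) \<and> (\<exists>i<m. g i \<noteq> e k i)"
  have step: "\<exists>b. ?P b \<and> ?R k a b" if "?P a" for a k
  proof -
    obtain n f where a: "a = (n, f)" by fastforce
    with that have f: "f \<in> q_expansions q x" "multiple (orb x f n)" by auto
    obtain \<eta> l where \<eta>: "\<eta> \<in> q_expansions q (orb x f n)"
        "multiple (q * orb (orb x f n) \<eta> l)" "multiple (q * orb (orb x f n) \<eta> l - 1)"
      using split[OF f(2)] by blast
    obtain h where h: "h \<in> q_expansions q x" "\<forall>i<n. h i = f i" "\<forall>i. h (n + i) = \<eta> i"
      using expansion_splice[OF f(1) \<eta>(1)] by blast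
    have "orb x h n = orb x f n" using h(2) by (intro orb_cong) auto
    then have w: "orb x h (n + l) = orb (orb x f n) \<eta> l"
      using h(3) by (simp add: orb_add)
    define d where "d = (if e k (n + l) = 0 then 1 else 0 :: nat)"
    have d: "d \<in> {0, 1}" "d \<noteq> e k (n + l)" by (auto simp: d_def)
    have m: "multiple (q * orb x h (n + l) - real d)"
      using \<eta> w by (auto simp: d_def)
    then obtain \<zeta> where "\<zeta> \<in> q_expansions q (q * orb x h (n + l) - real d)"
      by (auto simp: multiple_def)
    then have "case_nat d \<zeta> \<in> q_expansions q (orb x h (n + l))"
      using d by (simp add: expansion_Cons)
    then obtain g where g: "g \<in> q_expansions q x" "\<forall>i<n+l. g i = h i" "\<forall>i. g (n + l + i) = case_nat d \<zeta> i"
      using expansion_splice[OF h(1)] by blast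
    have gd: "g (n + l) = d" using g(3)[rule_format, of 0] by simp
    have "orb x g (n + l) = orb x h (n + l)" using g(2) by (intro orb_cong) auto
    then have "multiple (orb x g (Suc (n + l)))" using m gd by simp
    then have "?P (Suc (n + l), g) \<and> ?R k a (Suc (n + l), g)"
      using g(1,2) h(2) d gd a by auto
    then show ?thesis by blast
  qed
  obtain \<phi> where \<phi>: "\<And>k. ?P (\<phi> k)" "\<And>k. ?R k (\<phi> k) (\<phi> (Suc k))"
  proof -
    have "\<exists>f. \<forall>k. ?P (f k) \<and> ?R k (f k) (f (Suc k))"
    proof (rule dependent_nat_choice)
      obtain \<epsilon> where "\<epsilon> \<in> q_expansions q x"
        using assms(2) by (auto simp: multiple_def)
      then have "?P (0, \<epsilon>)" using assms(2) by simp
      then show "\<exists>a. ?P a" by blast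
    qed (use step in blast)
    then obtain \<phi> where "\<forall>k. ?P (\<phi> k) \<and> ?R k (\<phi> k) (\<phi> (Suc k))" ..
    note \<phi> = this[THEN spec]
    show thesis by (rule that[OF \<phi>[THEN conjunct1] \<phi>[THEN conjunct2]])
  qed
  define N where "N k = fst (\<phi> k)" for k
  define F where "F k = snd (\<phi> k)" for k
  have F: "F k \<in> q_expansions q x" "N k < N (Suc k)" "\<And>i. i < N k \<Longrightarrow> F (Suc k) i = F k i"
      "\<exists>i<N (Suc k). F (Suc k) i \<noteq> e k i" for k
    using \<phi>(1)[of k] \<phi>(2)[of k] by (auto simp: N_def F_def split: prod.splits)
  have Nmono: "strict_mono N" using F(2) by (rule strict_mono_Suc_iff[THEN iffD2, OF allI])
  then have Nge: "k \<le> N k" for k by (rule strict_mono_imp_increasing)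
  have stable: "F (k + l) i = F k i" if "i < N k" for k l i
  proof (induction l)
    case (Suc l)
    have "i < N (k + l)"
      using that Nmono by (metis le_add1 less_le_trans strict_mono_less_eq)
    then show ?case using Suc F(3) by simp
  qed simp
  define \<delta> where "\<delta> i = F (Suc i) i" for i
  have \<delta>: "\<delta> i = F k i" if "i < N k" for i k
  proof (cases "k \<le> Suc i")
    case True
    then show ?thesis using stable[OF that, of "Suc i - k"] by (simp add: \<delta>_def)
  next
    case False
    have "i < N (Suc i)" using Nge[of "Suc i"] by simp
    then show ?thesis using stable[of i "Suc i" "k - Suc i"] False by (simp add: \<delta>_def)
  qed
  have "orb x \<delta> k = orb x (F k) k" for k
    using Nge[of k] by (intro orb_cong \<delta>) simp
  then have "orb x \<delta> k \<in> {0..top_end}" for k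
    using F(1) unfolding expansion_iff_orb by metis
  moreover have "\<delta> i \<in> {0, 1}" for i
    using F(1)[of "Suc i"] unfolding \<delta>_def expansion_iff_orb by blast
  ultimately have "\<delta> \<in> q_expansions q x"
    unfolding expansion_iff_orb by blast
  then obtain k where k: "\<delta> = e k" using e by blast
  obtain i where "i < N (Suc k)" "F (Suc k) i \<noteq> e k i" using F(4) by blast
  with \<delta>[of i "Suc k"] k show False by simp
qed

end

section \<open>Points with a unique expansion\<close>

text \<open>
  The sextic has one sign change among its coefficients, so it changes sign only once on the
  positive axis: when \<open>x\<close> is scaled by \<open>r > 1\<close>, its leading term gains the factor \<open>r\<^sup>6\<close>, all the
  others at most \<open>r\<^sup>4\<close>.
\<close>
lemma sextic_pos_mono:
  fixes x y :: real
  assumes "0 < x" "x < y" "x ^ 4 + x ^ 3 + 2 * x\<^sup>2 + x + 1 \<le> x ^ 6"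
  shows "y ^ 4 + y ^ 3 + 2 * y\<^sup>2 + y + 1 < y ^ 6"
proof -
  define r where "r = y / x"
  have r: "1 < r" "y = r * x" using assms by (auto simp: r_def)
  have le: "r ^ k * z \<le> r ^ 4 * z" if "k \<le> 4" "0 \<le> z" for k z
    using r that by (intro mult_right_mono power_increasing) auto
  have "y ^ 4 + y ^ 3 + 2 * y\<^sup>2 + y + 1
      = r ^ 4 * x ^ 4 + r ^ 3 * x ^ 3 + r ^ 2 * (2 * x\<^sup>2) + r ^ 1 * x + r ^ 0 * 1"
    by (simp add: r power_mult_distrib)
  also have "\<dots> \<le> r ^ 4 * x ^ 4 + r ^ 4 * x ^ 3 + r ^ 4 * (2 * x\<^sup>2) + r ^ 4 * x + r ^ 4 * 1"
    using assms by (intro add_mono le) auto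
  also have "\<dots> = r ^ 4 * (x ^ 4 + x ^ 3 + 2 * x\<^sup>2 + x + 1)"
    by (simp add: algebra_simps)
  also have "\<dots> \<le> r ^ 4 * x ^ 6"
    using assms r by (intro mult_left_mono) auto
  also have "\<dots> < r ^ 6 * x ^ 6"
    using assms r by (intro mult_strict_right_mono power_strict_increasing) auto
  also have "\<dots> = y ^ 6" by (simp add: r power_mult_distrib)
  finally show ?thesis .
qed

context base
begin

definition simple :: "real \<Rightarrow> bool" where
  "simple x \<longleftrightarrow> x \<in> {0..top_end} \<and> \<not> multiple x"

lemma simple_child:
  assumes "simple x" "d \<in> {0, 1}" "q * x - real d \<in> {0..top_end}"
  shows "simple (q * x - real d)"
  using assms multiple_parent unfolding simple_def by blast

lemma simple_child_0:
  assumes "simple x" "q * x \<le> top_end"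
  shows "simple (q * x)"
  using simple_child[of x 0] assms q_gt_1 by (auto simp: simple_def)

lemma simple_child_1:
  assumes "simple x" "1 \<le> q * x"
  shows "simple (q * x - 1)"
proof -
  have "q * x \<le> q * top_end" using assms q_gt_1 by (auto simp: simple_def)
  then show ?thesis using simple_child[of x 1] assms top_end_fixed by auto
qed

lemma simple_not_switch: "simple x \<Longrightarrow> x \<notin> switch"
  using switch_imp_multiple by (auto simp: simple_def)

lemma simple_reflect: "simple x \<Longrightarrow> simple (top_end - x)"
  using multiple_reflect[of "top_end - x"] by (auto simp: simple_def)

end

locale above_golden = base +
  assumes golden_less: "q + 1 < q\<^sup>2"
begin

lemma q2_pos: "0 < q\<^sup>2 - 1"
  using golden_less q_gt_1 by simp

lemma top_end_scaled: "top_end * (q\<^sup>2 - 1) = q + 1"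
  using q_gt_1 by (simp add: top_end_def field_simps power2_eq_square)

lemma q_bounds:
  assumes "q ^ 6 \<le> q ^ 4 + q ^ 3 + 2 * q\<^sup>2 + q + 1"
  shows "8 / 5 < q" "q < 33 / 20"
proof -
  show "8 / 5 < q"
  proof (rule ccontr)
    assume "\<not> 8 / 5 < q"
    then have "q * q \<le> 8 / 5 * q" using q_gt_1 by (intro mult_right_mono) auto
    with golden_less \<open>\<not> 8 / 5 < q\<close> show False by (simp add: power2_eq_square)
  qed
  have lt: "(33 / 20 :: real) ^ 4 + (33 / 20) ^ 3 + 2 * (33 / 20)\<^sup>2 + 33 / 20 + 1 < (33 / 20) ^ 6"
    by (simp add: eval_nat_numeral)
  show "q < 33 / 20"
  proof (rule ccontr)
    assume ge: "\<not> q < 33 / 20"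
    show False
    proof (cases "q = 33 / 20")
      case True
      then show False using leD[OF assms[unfolded True]] lt by blast
    next
      case False
      then have "q ^ 4 + q ^ 3 + 2 * q\<^sup>2 + q + 1 < q ^ 6"
        using ge lt by (intro sextic_pos_mono[of "33 / 20"]) auto
      then show False using assms by linarith
    qed
  qed
qed
text \<open>
  The point \<open>q/(q\<^sup>2-1)\<close> has the expansion \<open>(10)\<^sup>\<infinity>\<close>. Above the golden ratio, it and its images
  under division by powers of \<open>q\<close> lie outside the switch interval, and so does their whole orbit.
\<close>
lemma period_2_unique:
  "\<not> multiple ((1 / q) ^ k * (q / (q\<^sup>2 - 1)))"
proof
  let ?p = "q / (q\<^sup>2 - 1)"
  let ?V = "{(1 / q) ^ k * ?p | k. True}"
  note q2 = q2_pos
  have p_hi: "top_end < q * ?p"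
    using golden_less top_end_scaled q2 by (simp add: pos_less_divide_eq power2_eq_square)
  have small: "(1 / q) ^ Suc k * ?p < 1 / q" for k
  proof -
    have "(1 / q) ^ Suc k \<le> (1 / q) ^ 1"
      using q_gt_1 by (intro power_decreasing) auto
    then have "(1 / q) ^ Suc k * ?p \<le> (1 / q) * ?p"
      using q2 q_gt_1 by (intro mult_right_mono) auto
    also have "\<dots> = 1 / (q\<^sup>2 - 1)" using q_gt_1 by simp
    also have "\<dots> < 1 / q" using golden_less q_gt_1 by (intro divide_strict_left_mono) auto
    finally show ?thesis .
  qed
  have V_child: "q * y - real d \<in> ?V" if "y \<in> ?V" "d \<in> {0, 1}" "q * y - real d \<in> {0..top_end}" for y d
  proof -
    from that(1) obtain k where y: "y = (1 / q) ^ k * ?p" by blast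
    show ?thesis
    proof (cases k)
      case 0
      then have "d = 1" using that y p_hi by auto
      then have "q * y - real d = (1 / q) ^ 1 * ?p"
        using 0 y q2 q_gt_1 by (simp add: field_simps power2_eq_square)
      then show ?thesis by blast
    next
      case (Suc l)
      then have "q * y < 1" using small[of l] y q_gt_1 by (simp add: field_simps)
      then have "d = 0" using that by auto
      then have "q * y - real d = (1 / q) ^ l * ?p"
        using Suc y q_gt_1 by simp
      then show ?thesis by blast
    qed
  qed
  have V_switch: "y \<notin> switch" if "y \<in> ?V" for y
  proof -
    from that obtain k where y: "y = (1 / q) ^ k * ?p" by blast
    show ?thesis
    proof (cases k)
      case 0
      then show ?thesis using y p_hi by (auto simp: switch_children)
    next
      case (Suc l)
      then show ?thesis using y small[of l] by (auto simp: switch_def)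
    qed
  qed
  assume "multiple ((1 / q) ^ k * ?p)"
  then obtain \<epsilon> n where \<epsilon>: "\<epsilon> \<in> q_expansions q ((1 / q) ^ k * ?p)" "orb ((1 / q) ^ k * ?p) \<epsilon> n \<in> switch"
    using multiple_imp_switch by blast
  have "orb ((1 / q) ^ k * ?p) \<epsilon> n \<in> ?V" for n
  proof (induction n)
    case (Suc n)
    have "\<epsilon> n \<in> {0, 1}" "orb ((1 / q) ^ k * ?p) \<epsilon> (Suc n) \<in> {0..top_end}"
      using \<epsilon>(1) unfolding expansion_iff_orb by blast+
    then show ?case using V_child[OF Suc] by simp
  qed auto
  then show False using \<epsilon>(2) V_switch by blast
qed

end

text \<open>
  The second condition, which bounds \<open>q\<close> from above by the square of the root of \<open>z\<^sup>3 = z + 1\<close> (about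
  \<open>1.7549\<close>), says that \<open>q - 1\<close> is less than the right end of the switch interval.
\<close>
locale few_simple = above_golden +
  assumes central_gap: "q * (q - 1)\<^sup>2 < 1"
begin

text \<open>
  The map \<open>T\<^sub>0 \<circ> T\<^sub>1\<close> sends a simple point between the switch interval and \<open>1\<close> to a point of the
  same kind, for both \<open>T\<^sub>1 a\<close> and \<open>T\<^sub>0 (T\<^sub>1 a)\<close> would otherwise lie in the switch interval. As the map
  expands by the factor \<open>q\<^sup>2\<close>, such a point can only be its fixed point.
\<close>
lemma simple_period_2:
  assumes "simple a" "top_end / q < a" "a < 1"
  shows "a = q / (q\<^sup>2 - 1)"
proof -
  let ?p = "q / (q\<^sup>2 - 1)"
  note q2 = q2_pos
  have p: "q\<^sup>2 * ?p - q = ?p" using q2 by (simp add: field_simps power2_eq_square)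
  have step: "simple (q\<^sup>2 * x - q) \<and> top_end / q < q\<^sup>2 * x - q \<and> q\<^sup>2 * x - q < 1"
    if x: "simple x" "top_end / q < x" "x < 1" for x
  proof -
    have tx: "top_end < q * x" using x(2) q_gt_1 by (simp add: field_simps)
    then have s1: "simple (q * x - 1)"
      using x(1) top_end_gt_1 by (intro simple_child_1) auto
    have "q * x < q" using x(3) q_gt_1 by simp
    have "q * (q - 1) * (q - 1) < 1" using central_gap by (simp add: power2_eq_square)
    then have "q - 1 < top_end / q"
      using q_gt_1 by (simp add: top_end_def field_simps)
    then have "q * x - 1 \<le> top_end / q" using \<open>q * x < q\<close> by simp
    with simple_not_switch[OF s1] have "q * x - 1 < 1 / q"
      by (auto simp: switch_def)
    then have lt1: "q * (q * x - 1) < 1" using q_gt_1 by (simp add: field_simps)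
    then have s2: "simple (q * (q * x - 1))"
      using top_end_gt_1 s1 by (intro simple_child_0) auto
    have "q * (q - 1) * (q - 1) \<le> 1" using \<open>q * (q - 1) * (q - 1) < 1\<close> by simp
    then have "1 / q \<le> q * (top_end - 1)"
      using q_gt_1 by (simp add: top_end_def field_simps)
    also have "q * (top_end - 1) \<le> q * (q * x - 1)"
      using tx q_gt_1 by (intro mult_left_mono) auto
    finally have "top_end / q < q * (q * x - 1)"
      using simple_not_switch[OF s2] by (auto simp: switch_def)
    with s2 lt1 show ?thesis by (simp add: power2_eq_square right_diff_distrib mult.assoc)
  qed
  have it: "simple (?p + (q\<^sup>2) ^ n * (a - ?p)) \<and> top_end / q < ?p + (q\<^sup>2) ^ n * (a - ?p)
       \<and> ?p + (q\<^sup>2) ^ n * (a - ?p) < 1" for n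
  proof (induction n)
    case 0
    show ?case using assms by simp
  next
    case (Suc n)
    have "q\<^sup>2 * (?p + (q\<^sup>2) ^ n * (a - ?p)) - q = ?p + (q\<^sup>2) ^ Suc n * (a - ?p)"
      using p by (simp add: distrib_left mult.assoc)
    then show ?case using step[of "?p + (q\<^sup>2) ^ n * (a - ?p)"] Suc by metis
  qed
  have "0 < top_end / q" using q_gt_1 top_end_gt_1 by simp
  show ?thesis
  proof (rule ccontr)
    assume "a \<noteq> ?p"
    then have "0 < \<bar>a - ?p\<bar>" by simp
    obtain n where n: "(1 + ?p) / \<bar>a - ?p\<bar> < (q\<^sup>2) ^ n"
      using real_arch_pow[of "q\<^sup>2" "(1 + ?p) / \<bar>a - ?p\<bar>"] q2 by auto
    then have "1 + ?p < (q\<^sup>2) ^ n * \<bar>a - ?p\<bar>"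
      using \<open>0 < \<bar>a - ?p\<bar>\<close> by (simp add: field_simps)
    also have "\<dots> = \<bar>(q\<^sup>2) ^ n * (a - ?p)\<bar>"
      using q2 by (simp add: abs_mult)
    finally have "1 + ?p < \<bar>(q\<^sup>2) ^ n * (a - ?p)\<bar>" .
    moreover have "0 < ?p" using q2 q_gt_1 by simp
    moreover have "0 < ?p + (q\<^sup>2) ^ n * (a - ?p)" "?p + (q\<^sup>2) ^ n * (a - ?p) < 1"
      using it[of n] \<open>0 < top_end / q\<close> by linarith+
    ultimately show False by linarith
  qed
qed

definition inv_powers :: "real set" where
  "inv_powers = insert 0 {(1 / q) ^ j | j. 1 \<le> j}"

text \<open>
  Below the switch interval, digit \<open>0\<close> is forced, so the point is multiplied by \<open>q\<close> until it jumps
  over the switch interval. It then lies below \<open>1\<close>, and \<open>simple_period_2\<close> says where.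
\<close>
lemma simple_le_imp_inv_power:
  assumes "simple u" "u \<le> top_end - 1"
  shows "u * (q\<^sup>2 - 1) \<in> inv_powers"
proof (cases "u = 0")
  case True
  then show ?thesis by (simp add: inv_powers_def)
next
  case False
  then have "0 < u" using assms(1) by (simp add: simple_def)
  note q2 = q2_pos
  obtain n where "1 / (q * u) < q ^ n"
    using real_arch_pow[OF q_gt_1] by blast
  then have ex: "1 / q \<le> q ^ n * u"
    using q_gt_1 \<open>0 < u\<close> by (simp add: field_simps)
  define k where "k = (LEAST k. 1 / q \<le> q ^ k * u)"
  have k: "1 / q \<le> q ^ k * u" unfolding k_def by (rule LeastI) (rule ex)
  have before: "q ^ i * u < 1 / q" if "i < k" for i
    using not_less_Least that unfolding k_def by (meson not_le)
  have sim: "simple (q ^ i * u)" if "i \<le> k" for i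
    using that
  proof (induction i)
    case (Suc i)
    then have "q * (q ^ i * u) < 1"
      using before[of i] q_gt_1 by (simp add: field_simps)
    then have "simple (q * (q ^ i * u))"
      using Suc top_end_gt_1 by (intro simple_child_0) auto
    then show ?case by (simp add: mult.assoc)
  qed (use assms in simp)
  have hi: "top_end / q < q ^ k * u"
    using simple_not_switch[OF sim[OF order_refl]] k by (auto simp: switch_def)
  have "(q\<^sup>2 - q - 1) > 0" using golden_less by simp
  then have "top_end - 1 < 1 / q"
    using q_gt_1 by (simp add: top_end_def field_simps power2_eq_square)
  then have "k \<noteq> 0" using k assms(2) by (cases k) auto
  then have "q * (q ^ (k - 1) * u) < 1"
    using before[of "k - 1"] q_gt_1 by (simp add: field_simps)
  then have "q ^ k * u < 1"
    using \<open>k \<noteq> 0\<close> by (metis mult.assoc power_eq_if)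
  then have "q ^ k * u = q / (q\<^sup>2 - 1)"
    by (rule simple_period_2[OF sim[OF order_refl] hi])
  then have "q * (q ^ (k - 1) * u) = q * (1 / (q\<^sup>2 - 1))"
    using \<open>k \<noteq> 0\<close> by (cases k) (auto simp: mult.assoc)
  then have "q ^ (k - 1) * u = 1 / (q\<^sup>2 - 1)"
    using q_gt_1 by (simp only: mult_cancel_left) simp
  then have "q ^ (k - 1) * u * (q\<^sup>2 - 1) = 1"
    using q2 by simp
  then have val: "u * (q\<^sup>2 - 1) = (1 / q) ^ (k - 1)"
    using q_gt_1 by (simp add: power_divide field_simps)
  have "u * (q\<^sup>2 - 1) \<le> (top_end - 1) * (q\<^sup>2 - 1)"
    using assms(2) q2 by (intro mult_right_mono) auto
  also have "\<dots> < 1" using top_end_scaled golden_less by (simp add: algebra_simps)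
  finally have "k - 1 \<noteq> 0" using val by (intro notI) simp
  then have "1 \<le> k - 1" by simp
  then show ?thesis unfolding val inv_powers_def by blast
qed

end

section \<open>Bases between the golden ratio and the root of the sextic\<close>

locale gap = above_golden +
  assumes sextic_neg: "q ^ 6 < q ^ 4 + q ^ 3 + 2 * q\<^sup>2 + q + 1"
begin

lemma gap_bounds: "8 / 5 < q" "q < 33 / 20"
  using q_bounds sextic_neg by auto

text \<open>
  Everything is controlled by \<open>u = q\<^sup>2 - q - 1\<close>, which is positive but less than \<open>3/40\<close> here. All
  these polynomials simplify when \<open>u\<close> is taken out.
\<close>
lemma poly_bounds:
  "q ^ 5 - q ^ 4 - q ^ 3 - q + 1 \<le> 0"
  "1 < q * (q ^ 3 * (2 + q - q\<^sup>2) - q - (q\<^sup>2 - 1))"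
  "1 < q * (q ^ 4 * (2 + q - q\<^sup>2) - q ^ 3 - (q\<^sup>2 - 1))"
  "q\<^sup>2 * ((q\<^sup>2 - q - 1) * (q ^ 4 - q\<^sup>2 - 1)) < 1"
  "q\<^sup>2 * ((q\<^sup>2 - q - 1) * (q ^ 3 - q - 1)) < 1"
  "q + 1 < q\<^sup>2 * (q ^ 4 - q\<^sup>2 - 1)"
  "q + 1 < q\<^sup>2 * (q ^ 3 - q - 1)"
proof -
  define u where "u = q\<^sup>2 - q - 1"
  have u0: "0 < u" using golden_less by (simp add: u_def)
  have "q * (q - 1) \<le> 33 / 20 * (13 / 20)" using gap_bounds by (intro mult_mono) auto
  then have u1: "u < 3 / 40" by (simp add: u_def power2_eq_square right_diff_distrib)
  have sq: "13 / 5 < q\<^sup>2" "q\<^sup>2 < 109 / 40"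
    using u0 u1 gap_bounds by (auto simp: u_def)
  have cub: "5 / 2 \<le> q * (q\<^sup>2 - 1)" "q * (q\<^sup>2 - 1) \<le> 3"
    using mult_mono[of "8 / 5" q "8 / 5" "q\<^sup>2 - 1"] mult_mono[of q "33 / 20" "q\<^sup>2 - 1" "69 / 40"] gap_bounds sq
    by auto
  have quart: "4 \<le> q\<^sup>2 * (q\<^sup>2 - 1)" "q\<^sup>2 * (q\<^sup>2 - 1) \<le> 19 / 4"
    using mult_mono[of "13 / 5" "q\<^sup>2" "8 / 5" "q\<^sup>2 - 1"] mult_mono[of "q\<^sup>2" "109 / 40" "q\<^sup>2 - 1" "69 / 40"] sq
    by auto
  have u_le: "u * a \<le> 3 / 40 * a" if "0 \<le> a" for a
    using u1 that by (intro mult_right_mono) auto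
  have "q ^ 5 - q ^ 4 - q ^ 3 - q + 1 = u * (q * (q\<^sup>2 - 1)) + u * q - q + 1"
    by (simp add: u_def eval_nat_numeral algebra_simps)
  then show "q ^ 5 - q ^ 4 - q ^ 3 - q + 1 \<le> 0"
    using u_le[of "q * (q\<^sup>2 - 1)"] u_le[of q] cub gap_bounds by linarith
  have gt1: "1 < q * (1 - u * a)" if "0 \<le> a" "a \<le> 19 / 4" for a
    using mult_mono[of "8 / 5" q "16 / 25" "1 - u * a"] u_le[OF that(1)] that gap_bounds by auto
  have eq3: "q * (q ^ 3 * (2 + q - q\<^sup>2) - q - (q\<^sup>2 - 1)) = q * (1 - u * (q * (q\<^sup>2 - 1)))"
    by (simp add: u_def eval_nat_numeral algebra_simps)
  show "1 < q * (q ^ 3 * (2 + q - q\<^sup>2) - q - (q\<^sup>2 - 1))"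
    unfolding eq3 by (intro gt1) (use cub in linarith)+
  have eq4: "q * (q ^ 4 * (2 + q - q\<^sup>2) - q ^ 3 - (q\<^sup>2 - 1)) = q * (1 - u * (q\<^sup>2 * (q\<^sup>2 - 1)))"
    by (simp add: u_def eval_nat_numeral algebra_simps)
  show "1 < q * (q ^ 4 * (2 + q - q\<^sup>2) - q ^ 3 - (q\<^sup>2 - 1))"
    unfolding eq4 by (intro gt1) (use quart in linarith)+
  have lt1: "q\<^sup>2 * (u * a) < 1" if "0 \<le> a" "a \<le> 4" for a
    using mult_mono[of "q\<^sup>2" "109 / 40" "u * a" "3 / 10"] u_le[OF that(1)] u0 that sq by auto
  have a: "q\<^sup>2 * (q\<^sup>2 - 1) - 1 = q ^ 4 - q\<^sup>2 - 1" and b: "q * (q\<^sup>2 - 1) - 1 = q ^ 3 - q - 1"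
    by (simp_all add: eval_nat_numeral algebra_simps)
  have a': "1 \<le> q ^ 4 - q\<^sup>2 - 1" "q ^ 4 - q\<^sup>2 - 1 \<le> 4" using quart a by linarith+
  have b': "1 \<le> q ^ 3 - q - 1" "q ^ 3 - q - 1 \<le> 4" using cub b by linarith+
  show "q\<^sup>2 * ((q\<^sup>2 - q - 1) * (q ^ 4 - q\<^sup>2 - 1)) < 1"
    unfolding u_def[symmetric] by (intro lt1) (use a' in linarith)+
  show "q\<^sup>2 * ((q\<^sup>2 - q - 1) * (q ^ 3 - q - 1)) < 1"
    unfolding u_def[symmetric] by (intro lt1) (use b' in linarith)+
  have "q\<^sup>2 * 1 \<le> q\<^sup>2 * (q ^ 4 - q\<^sup>2 - 1)" "q\<^sup>2 * 1 \<le> q\<^sup>2 * (q ^ 3 - q - 1)"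
    using a' b' by (intro mult_left_mono; simp)+
  then show "q + 1 < q\<^sup>2 * (q ^ 4 - q\<^sup>2 - 1)" "q + 1 < q\<^sup>2 * (q ^ 3 - q - 1)"
    using golden_less by linarith+
qed

sublocale few_simple
proof
  have "(q - 1)\<^sup>2 \<le> (13 / 20)\<^sup>2" using gap_bounds by (intro power_mono) auto
  then have "q * (q - 1)\<^sup>2 \<le> 33 / 20 * (13 / 20)\<^sup>2" using gap_bounds by (intro mult_mono) auto
  also have "\<dots> < (1::real)" by (simp add: power2_eq_square)
  finally show "q * (q - 1)\<^sup>2 < 1" .
qed

lemma inv_powers_cases:
  assumes "t \<in> inv_powers"
  obtains "t = 0" | j where "1 \<le> j" "t = (1 / q) ^ j"
  using assms unfolding inv_powers_def by blast

lemma inv_powers_le: "t \<in> inv_powers \<Longrightarrow> 0 \<le> t \<and> t \<le> 1 / q"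
proof (erule inv_powers_cases)
  fix j :: nat assume "1 \<le> j" "t = (1 / q) ^ j"
  then show "0 \<le> t \<and> t \<le> 1 / q"
    using q_gt_1 power_decreasing[of 1 j "1 / q"] by simp
qed (use q_gt_1 in simp)

lemma inv_powers_gap:
  assumes "t \<in> inv_powers" "t \<noteq> 1 / q" "t \<noteq> (1 / q)\<^sup>2"
  shows "t \<le> (1 / q) ^ 3"
  using assms(1)
proof (cases rule: inv_powers_cases)
  case (2 j)
  then have "j \<noteq> 1" "j \<noteq> 2" using assms by auto
  then have "3 \<le> j" using 2 by simp
  then show ?thesis using 2 q_gt_1 power_decreasing[of 3 j "1 / q"] by simp
qed (use q_gt_1 in simp)

text \<open>
  The right-hand side \<open>g\<close> lies strictly between two consecutive sums of two elements. The
  inequality \<open>g < q\<^sup>-\<^sup>1 + q\<^sup>-\<^sup>2\<close> amounts to \<open>0 < (q\<^sup>2-q-1)(q\<^sup>4-1)\<close>, so it uses that \<open>q\<close> exceeds the golden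
  ratio, and \<open>q\<^sup>-\<^sup>1 + q\<^sup>-\<^sup>3 < g\<close> is, up to the factor \<open>q - 1\<close>, the sextic inequality. All other sums are
  at most \<open>q\<^sup>-\<^sup>1 + q\<^sup>-\<^sup>3\<close> or at least \<open>q\<^sup>-\<^sup>1 + q\<^sup>-\<^sup>2\<close>.
\<close>
lemma inv_powers_sum:
  assumes "a \<in> inv_powers" "b \<in> inv_powers"
  shows "a + b \<noteq> 1 + q\<^sup>2 + q ^ 3 - q ^ 4"
proof -
  define s where "s = 1 / q"
  let ?g = "1 + q\<^sup>2 + q ^ 3 - q ^ 4"
  have s: "0 < s" "s < 1" "q * s = 1" using q_gt_1 by (auto simp: s_def)
  have s_pow: "q ^ k * s ^ k = 1" for k
    using s(3) by (simp flip: power_mult_distrib)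
  have "0 < (q\<^sup>2 - q - 1) * (q ^ 4 - 1)"
    using golden_less q_gt_1 by (intro mult_pos_pos) auto
  also have "\<dots> = q * (q * s) + q\<^sup>2 * s\<^sup>2 - q\<^sup>2 * ?g"
    unfolding s(3) s_pow by (simp add: eval_nat_numeral algebra_simps)
  also have "\<dots> = q\<^sup>2 * (s + s\<^sup>2 - ?g)"
    by (simp add: power2_eq_square algebra_simps)
  finally have one2: "?g < s + s\<^sup>2"
    using q_gt_1 by (simp add: zero_less_mult_iff)
  have "0 < (q - 1) * (q ^ 4 + q ^ 3 + 2 * q\<^sup>2 + q + 1 - q ^ 6)"
    using q_gt_1 sextic_neg by (intro mult_pos_pos) auto
  also have "\<dots> = q ^ 3 * ?g - q\<^sup>2 * (q * s) - q ^ 3 * s ^ 3"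
    unfolding s(3) s_pow by (simp add: eval_nat_numeral algebra_simps)
  also have "\<dots> = q ^ 3 * (?g - (s + s ^ 3))"
    by (simp add: eval_nat_numeral algebra_simps)
  finally have one3: "s + s ^ 3 < ?g"
    using q_gt_1 by (simp add: zero_less_mult_iff)
  have "0 \<le> s * (1 - s)\<^sup>2" using s by simp
  also have "\<dots> = s + s ^ 3 - (s\<^sup>2 + s\<^sup>2)"
    by (simp add: eval_nat_numeral algebra_simps)
  finally have two2: "s\<^sup>2 + s\<^sup>2 < ?g" using one3 by linarith
  have pows: "s ^ 3 \<le> s\<^sup>2" "s\<^sup>2 \<le> s"
    using s by (auto simp: eval_nat_numeral intro: mult_left_le mult_left_mono)
  have cases: "t = s \<or> t = s\<^sup>2 \<or> t \<le> s ^ 3" if "t \<in> inv_powers" for t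
    using inv_powers_gap[OF that] by (auto simp: s_def)
  show ?thesis
    using cases[OF assms(1)] cases[OF assms(2)] two2 one2 one3 pows by linarith
qed

text \<open>If \<open>T\<^sub>1 y = t/(q\<^sup>2-1)\<close>, then \<open>sibling t = T\<^sub>0 y\<close>.\<close>
definition sibling :: "real \<Rightarrow> real" where
  "sibling t = 1 + t / (q\<^sup>2 - 1)"

lemma switch_scaled:
  "y \<in> switch \<longleftrightarrow> q\<^sup>2 - 1 \<le> q * (y * (q\<^sup>2 - 1)) \<and> q * (y * (q\<^sup>2 - 1)) \<le> q + 1"
proof -
  have "y \<in> switch \<longleftrightarrow> 1 \<le> q * y \<and> q * y \<le> top_end"
    unfolding switch_def using q_gt_1 by (auto simp: field_simps)
  also have "\<dots> \<longleftrightarrow> 1 * (q\<^sup>2 - 1) \<le> (q * y) * (q\<^sup>2 - 1) \<and> (q * y) * (q\<^sup>2 - 1) \<le> top_end * (q\<^sup>2 - 1)"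
    using q2_pos by (simp only: mult_le_cancel_right_pos)
  finally show ?thesis by (simp add: top_end_scaled mult.assoc)
qed

end

text \<open>
  The aim is to show that such a \<open>D\<close> does not meet the switch interval: applied to the set of
  descendants of a multiple point and their reflections, this yields a descendant with two multiple
  children.
\<close>
locale unsplit = gap +
  fixes D :: "real set"
  assumes D_range: "y \<in> D \<Longrightarrow> y \<in> {0..top_end}"
    and D_child: "y \<in> D \<Longrightarrow> d \<in> {0, 1} \<Longrightarrow> q * y - real d \<in> {0..top_end} \<Longrightarrow> q * y - real d \<in> D"
    and D_reflect: "y \<in> D \<Longrightarrow> top_end - y \<in> D"
    and D_switch: "y \<in> D \<Longrightarrow> y \<in> switch \<Longrightarrow> simple (q * y) \<or> simple (q * y - 1)"
begin

lemma sibling_if_upper_simple: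
  assumes "y \<in> D" "y \<in> switch" "simple (q * y - 1)"
  shows "(q * y - 1) * (q\<^sup>2 - 1) \<in> inv_powers \<and> sibling ((q * y - 1) * (q\<^sup>2 - 1)) \<in> D"
proof
  have "q * y \<in> {0..top_end}" using assms(2) switch_children by blast
  then show "(q * y - 1) * (q\<^sup>2 - 1) \<in> inv_powers"
    using assms(3) by (intro simple_le_imp_inv_power) auto
  have "q * y \<in> D" using D_child[of y 0] assms(1) \<open>q * y \<in> {0..top_end}\<close> by simp
  moreover have "sibling ((q * y - 1) * (q\<^sup>2 - 1)) = q * y"
    using q2_pos by (simp add: sibling_def)
  ultimately show "sibling ((q * y - 1) * (q\<^sup>2 - 1)) \<in> D" by simp
qed

text \<open>This is the preceding lemma for the reflected point.\<close>
lemma sibling_if_lower_simple: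
  assumes "y \<in> D" "y \<in> switch" "simple (q * y)"
  shows "(top_end - q * y) * (q\<^sup>2 - 1) \<in> inv_powers \<and> sibling ((top_end - q * y) * (q\<^sup>2 - 1)) \<in> D"
proof -
  have eq: "q * (top_end - y) - 1 = top_end - q * y"
    using top_end_fixed by (simp add: right_diff_distrib)
  have "top_end - y \<in> switch"
    using assms(2) eq top_end_fixed unfolding switch_children by (auto simp: right_diff_distrib)
  then show ?thesis
    using sibling_if_upper_simple[of "top_end - y"] D_reflect[OF assms(1)] simple_reflect[OF assms(3)] eq
    by simp
qed

text \<open>
  Seen from the right end of the range, the orbit of \<open>sibling t\<close> under digits \<open>1\<close> is multiplication
  of its distance \<open>r\<close> by \<open>q\<close>. The bounds \<open>lo\<close> and \<open>hi\<close> say that \<open>q ^ n * r\<close> lies in the switch interval;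
  the two alternatives are that its child under digit \<open>1\<close>, or that under digit \<open>0\<close>, is simple.
\<close>
lemma sibling_step:
  assumes "sibling t \<in> D"
    and lo: "q\<^sup>2 - 1 \<le> q ^ Suc n * (2 + q - q\<^sup>2 - t)"
    and hi: "q ^ Suc n * (2 + q - q\<^sup>2 - t) \<le> q + 1"
  shows "q ^ Suc n * (2 + q - q\<^sup>2 - t) - (q\<^sup>2 - 1) \<in> inv_powers \<or>
    (q + 1 - q ^ Suc n * (2 + q - q\<^sup>2 - t) \<in> inv_powers \<and>
     sibling (q + 1 - q ^ Suc n * (2 + q - q\<^sup>2 - t)) \<in> D)"
proof -
  define r where "r = top_end - sibling t"
  have r: "r * (q\<^sup>2 - 1) = 2 + q - q\<^sup>2 - t"
    using q2_pos top_end_scaled by (simp add: r_def sibling_def field_simps)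
  have v: "q ^ n * r \<in> switch"
    using lo hi unfolding switch_scaled r[symmetric] by (simp add: mult.assoc)
  have "r \<in> D" using assms(1) D_reflect by (simp add: r_def)
  then have "0 \<le> r" using D_range by auto
  have "q ^ i * r \<in> D" if "i \<le> n" for i
    using that
  proof (induction i)
    case (Suc i)
    have "q ^ Suc i * r \<le> q ^ n * r"
      using Suc.prems q_gt_1 \<open>0 \<le> r\<close> by (intro mult_right_mono power_increasing) auto
    also have "\<dots> \<le> top_end"
      using switch_imp_multiple[OF v] multiple_range by auto
    finally show ?case
      using D_child[of "q ^ i * r" 0] Suc \<open>0 \<le> r\<close> q_gt_1 by (simp add: mult.assoc)
  qed (use \<open>r \<in> D\<close> in simp)
  then have vD: "q ^ n * r \<in> D" by simp
  have up: "(q * (q ^ n * r) - 1) * (q\<^sup>2 - 1) = q ^ Suc n * (2 + q - q\<^sup>2 - t) - (q\<^sup>2 - 1)"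
    unfolding r[symmetric] by (simp add: algebra_simps)
  have down: "(top_end - q * (q ^ n * r)) * (q\<^sup>2 - 1) = q + 1 - q ^ Suc n * (2 + q - q\<^sup>2 - t)"
    unfolding r[symmetric] top_end_scaled[symmetric] by (simp add: algebra_simps)
  show ?thesis
    using D_switch[OF vD v] sibling_if_upper_simple[OF vD v] sibling_if_lower_simple[OF vD v]
    unfolding up down by blast
qed

text \<open>For small \<open>t\<close>, a single digit \<open>1\<close> leads from \<open>sibling t\<close> into the switch interval.\<close>
lemma sibling_small:
  assumes "t \<in> inv_powers" "t \<le> (1 / q) ^ 3" "sibling t \<in> D"
  shows "q\<^sup>2 * t + (q\<^sup>2 - q - 1) * (q\<^sup>2 - 1) \<in> inv_powers \<and>
         sibling (q\<^sup>2 * t + (q\<^sup>2 - q - 1) * (q\<^sup>2 - 1)) \<in> D"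
proof -
  let ?h = "q ^ Suc 1 * (2 + q - q\<^sup>2 - t)"
  have t0: "0 \<le> t" using inv_powers_le assms(1) by blast
  have f: "0 < (q\<^sup>2 - q - 1) * (q\<^sup>2 - 1)"
    using golden_less q2_pos by (intro mult_pos_pos) auto
  have eq: "q + 1 - ?h = q\<^sup>2 * t + (q\<^sup>2 - q - 1) * (q\<^sup>2 - 1)"
    by (simp add: eval_nat_numeral algebra_simps)
  have "q ^ 3 * t \<le> q ^ 3 * (1 / q) ^ 3" using assms(2) q_gt_1 by (intro mult_left_mono) auto
  then have "q ^ 3 * t \<le> 1" using q_gt_1 by (simp add: power_divide)
  moreover have "q * (?h - (q\<^sup>2 - 1)) = - (q ^ 5 - q ^ 4 - q ^ 3 - q + 1) + (1 - q ^ 3 * t)"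
    by (simp add: eval_nat_numeral algebra_simps)
  ultimately have "0 \<le> q * (?h - (q\<^sup>2 - 1))" using poly_bounds(1) by linarith
  then have lo: "q\<^sup>2 - 1 \<le> ?h" using q_gt_1 by (simp add: zero_le_mult_iff)
  have "0 \<le> q\<^sup>2 * t" using t0 by simp
  then have hi: "?h \<le> q + 1" using f eq by linarith
  have "q\<^sup>2 * t \<in> inv_powers"
    using assms(1)
  proof (cases rule: inv_powers_cases)
    case 1
    then show ?thesis by (simp add: inv_powers_def)
  next
    case (2 j)
    have "(1 / q) ^ j \<le> (1 / q) ^ 3" using 2 assms(2) by simp
    then have "3 \<le> j" using q_gt_1 by (subst (asm) power_decreasing_iff) auto
    then obtain k where k: "j = k + 2" "1 \<le> k" by (intro that[of "j - 2"]) auto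
    have "q\<^sup>2 * t = (1 / q) ^ k" unfolding 2(2) k(1) using q_gt_1 by (simp add: power_add power_divide power2_eq_square)
    then show ?thesis using k(2) unfolding inv_powers_def by blast
  qed
  moreover have "q\<^sup>2 * t + (?h - (q\<^sup>2 - 1)) = 1 + q\<^sup>2 + q ^ 3 - q ^ 4"
    by (simp add: eval_nat_numeral algebra_simps)
  ultimately have "?h - (q\<^sup>2 - 1) \<notin> inv_powers"
    using inv_powers_sum by metis
  then show ?thesis
    using sibling_step[OF assms(3) lo hi] unfolding eq by blast
qed

text \<open>
  If \<open>h = q\<^sup>-\<^sup>i\<close>, then by the last hypothesis the parameter that follows \<open>h\<close> lies strictly between
  \<open>q\<^sup>2 h\<close> and \<open>q\<^sup>3 h\<close>, which are consecutive powers of \<open>1/q\<close>.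
\<close>
lemma sibling_between_dead:
  assumes "h \<in> inv_powers" "sibling h \<in> D" "q\<^sup>2 * h < 1"
    "(q\<^sup>2 - q - 1) * (q\<^sup>2 - 1) < (q ^ 3 - q\<^sup>2) * h"
  shows False
proof -
  have f: "0 < (q\<^sup>2 - q - 1) * (q\<^sup>2 - 1)"
    using golden_less q2_pos by (intro mult_pos_pos) auto
  have "h \<noteq> 0" using f assms(4) by auto
  with assms(1) obtain i where i: "h = (1 / q) ^ i" by (cases rule: inv_powers_cases) auto
  have "(1 / q) ^ i < (1 / q)\<^sup>2"
    using assms(3) i q_gt_1 by (simp add: field_simps)
  then have "2 < i" using q_gt_1 by (subst (asm) power_strict_decreasing_iff) auto
  then obtain l where l: "i = l + 3" by (intro that[of "i - 3"]) auto
  have "h \<le> (1 / q) ^ 3" unfolding i l using q_gt_1 by (intro power_decreasing) auto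
  from sibling_small[OF assms(1) this assms(2)]
  have "q\<^sup>2 * h + (q\<^sup>2 - q - 1) * (q\<^sup>2 - 1) \<in> inv_powers" by blast
  then obtain k where k: "q\<^sup>2 * h + (q\<^sup>2 - q - 1) * (q\<^sup>2 - 1) = (1 / q) ^ k"
  proof (cases rule: inv_powers_cases)
    case 1
    have "0 \<le> q\<^sup>2 * h" using inv_powers_le[OF assms(1)] by simp
    with 1 f show ?thesis by linarith
  qed (use that in blast)
  have q2h: "q\<^sup>2 * h = (1 / q) ^ (l + 1)" and q3h: "q ^ 3 * h = (1 / q) ^ l"
    unfolding i l using q_gt_1 by (simp_all add: power_add power_divide eval_nat_numeral)
  have "(1 / q) ^ (l + 1) < (1 / q) ^ k" using k f q2h by linarith
  then have "k < l + 1" using q_gt_1 by (subst (asm) power_strict_decreasing_iff) auto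
  moreover have "(1 / q) ^ k < (1 / q) ^ l" using k assms(4) q3h by (simp add: left_diff_distrib)
  then have "l < k" using q_gt_1 by (subst (asm) power_strict_decreasing_iff) auto
  ultimately show False by simp
qed

text \<open>
  The orbit of \<open>sibling (1/q)\<close> enters the switch interval after three digits \<open>1\<close>, and that of
  \<open>sibling ((1/q)\<^sup>2)\<close> after two. In both cases, reflect the point reached as in \<open>sibling_step\<close>. Its child
  under digit \<open>1\<close> cannot be simple, because the parameter of that child would exceed \<open>1/q\<close>, and
  its other child gives a parameter to which \<open>sibling_between_dead\<close> applies.
\<close>
lemma sibling_1_dead: "sibling (1 / q) \<notin> D"
proof
  assume D: "sibling (1 / q) \<in> D"
  let ?h = "q ^ Suc 3 * (2 + q - q\<^sup>2 - 1 / q)"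
  let ?t = "(q\<^sup>2 - q - 1) * (q ^ 4 - q\<^sup>2 - 1)"
  have h: "?h = q ^ 4 * (2 + q - q\<^sup>2) - q ^ 3"
    using q_gt_1 by (simp add: eval_nat_numeral algebra_simps)
  have eq: "q + 1 - ?h = ?t"
    unfolding h by (simp add: eval_nat_numeral algebra_simps)
  have q: "q + 1 < q\<^sup>2 * (q ^ 4 - q\<^sup>2 - 1)" by (rule poly_bounds)
  then have "0 < q ^ 4 - q\<^sup>2 - 1"
    using q_gt_1 by (smt (verit) zero_less_mult_pos zero_less_power)
  then have hi: "?h \<le> q + 1" using golden_less eq by (smt (verit) mult_pos_pos)
  have big: "1 / q < ?h - (q\<^sup>2 - 1)"
    using poly_bounds(3) q_gt_1 unfolding h by (simp add: divide_less_eq mult.commute)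
  moreover have "0 < 1 / q" using q_gt_1 by simp
  ultimately have lo: "q\<^sup>2 - 1 \<le> ?h" by linarith
  have "?h - (q\<^sup>2 - 1) \<notin> inv_powers" using big inv_powers_le by fastforce
  then have t: "?t \<in> inv_powers" "sibling ?t \<in> D"
    using sibling_step[OF D lo hi] unfolding eq by blast+
  show False
  proof (rule sibling_between_dead[OF t])
    show "q\<^sup>2 * ?t < 1" by (rule poly_bounds)
    have "(q + 1) * ((q\<^sup>2 - q - 1) * (q - 1)) < q\<^sup>2 * (q ^ 4 - q\<^sup>2 - 1) * ((q\<^sup>2 - q - 1) * (q - 1))"
      using q golden_less q_gt_1 by (intro mult_strict_right_mono mult_pos_pos) auto
    then show "(q\<^sup>2 - q - 1) * (q\<^sup>2 - 1) < (q ^ 3 - q\<^sup>2) * ?t"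
      by (simp add: eval_nat_numeral algebra_simps)
  qed
qed

lemma sibling_2_dead: "sibling ((1 / q)\<^sup>2) \<notin> D"
proof
  assume D: "sibling ((1 / q)\<^sup>2) \<in> D"
  let ?h = "q ^ Suc 2 * (2 + q - q\<^sup>2 - (1 / q)\<^sup>2)"
  let ?t = "(q\<^sup>2 - q - 1) * (q ^ 3 - q - 1)"
  have h: "?h = q ^ 3 * (2 + q - q\<^sup>2) - q"
    using q_gt_1 by (simp add: eval_nat_numeral algebra_simps)
  have eq: "q + 1 - ?h = ?t"
    unfolding h by (simp add: eval_nat_numeral algebra_simps)
  have q: "q + 1 < q\<^sup>2 * (q ^ 3 - q - 1)" by (rule poly_bounds)
  then have "0 < q ^ 3 - q - 1"
    using q_gt_1 by (smt (verit) zero_less_mult_pos zero_less_power)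
  then have hi: "?h \<le> q + 1" using golden_less eq by (smt (verit) mult_pos_pos)
  have big: "1 / q < ?h - (q\<^sup>2 - 1)"
    using poly_bounds(2) q_gt_1 unfolding h by (simp add: divide_less_eq mult.commute)
  moreover have "0 < 1 / q" using q_gt_1 by simp
  ultimately have lo: "q\<^sup>2 - 1 \<le> ?h" by linarith
  have "?h - (q\<^sup>2 - 1) \<notin> inv_powers" using big inv_powers_le by fastforce
  then have t: "?t \<in> inv_powers" "sibling ?t \<in> D"
    using sibling_step[OF D lo hi] unfolding eq by blast+
  show False
  proof (rule sibling_between_dead[OF t])
    show "q\<^sup>2 * ?t < 1" by (rule poly_bounds)
    have "(q + 1) * ((q\<^sup>2 - q - 1) * (q - 1)) < q\<^sup>2 * (q ^ 3 - q - 1) * ((q\<^sup>2 - q - 1) * (q - 1))"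
      using q golden_less q_gt_1 by (intro mult_strict_right_mono mult_pos_pos) auto
    then show "(q\<^sup>2 - q - 1) * (q\<^sup>2 - 1) < (q ^ 3 - q\<^sup>2) * ?t"
      by (simp add: eval_nat_numeral algebra_simps)
  qed
qed

text \<open>
  By \<open>sibling_small\<close> the parameter grows by a factor of more than \<open>q\<^sup>2\<close> in each step, so the exponent
  descends to one of the two cases above.
\<close>
lemma sibling_power_dead: "1 \<le> j \<Longrightarrow> sibling ((1 / q) ^ j) \<notin> D"
proof (induction j rule: less_induct)
  case (less j)
  show ?case
  proof (cases "j \<le> 2")
    case True
    then have "j = 1 \<or> j = 2" using less.prems by auto
    then show ?thesis using sibling_1_dead sibling_2_dead by auto
  next
    case False
    show ?thesis
    proof
      assume D: "sibling ((1 / q) ^ j) \<in> D"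
      let ?t = "q\<^sup>2 * (1 / q) ^ j + (q\<^sup>2 - q - 1) * (q\<^sup>2 - 1)"
      have P: "(1 / q) ^ j \<in> inv_powers" using less.prems by (auto simp: inv_powers_def)
      have "(1 / q) ^ j \<le> (1 / q) ^ 3"
        using False q_gt_1 by (intro power_decreasing) auto
      then have t: "?t \<in> inv_powers" "sibling ?t \<in> D" using sibling_small[OF P _ D] by blast+
      have f: "0 < (q\<^sup>2 - q - 1) * (q\<^sup>2 - 1)"
        using golden_less q2_pos by (intro mult_pos_pos) auto
      have "0 < (1 / q) ^ j" using q_gt_1 by simp
      moreover have "1 * (1 / q) ^ j \<le> q\<^sup>2 * (1 / q) ^ j"
        using q2_pos q_gt_1 by (intro mult_right_mono) auto
      ultimately have gt: "(1 / q) ^ j < ?t" "?t \<noteq> 0" using f by linarith+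
      from t(1) gt(2) obtain i where i: "1 \<le> i" "?t = (1 / q) ^ i"
        by (auto elim: inv_powers_cases)
      have "(1 / q) ^ j < (1 / q) ^ i" using gt(1) i(2) by simp
      then have "i < j" using q_gt_1 by (subst (asm) power_strict_decreasing_iff) auto
      then show False using less.IH i t(2) by simp
    qed
  qed
qed

lemma sibling_dead: "t \<in> inv_powers \<Longrightarrow> sibling t \<notin> D"
proof (erule inv_powers_cases)
  assume t: "t = 0"
  show "sibling t \<notin> D"
  proof
    assume D: "sibling t \<in> D"
    let ?f = "(q\<^sup>2 - q - 1) * (q\<^sup>2 - 1)"
    have "?f \<in> inv_powers \<and> sibling ?f \<in> D"
      using sibling_small[of 0] D t q_gt_1 by (simp add: inv_powers_def)
    moreover have "0 < ?f"
      using golden_less q2_pos by (intro mult_pos_pos) auto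
    ultimately show False
      using sibling_power_dead by (auto elim!: inv_powers_cases)
  qed
qed (use sibling_power_dead in blast)

lemma D_avoids_switch:
  assumes "y \<in> D"
  shows "y \<notin> switch"
  using D_switch[OF assms] sibling_if_upper_simple[OF assms] sibling_if_lower_simple[OF assms] sibling_dead
  by blast

end

context gap
begin

lemma multiple_splits:
  assumes "multiple x"
  shows "\<exists>\<epsilon> \<in> q_expansions q x. \<exists>n. multiple (q * orb x \<epsilon> n) \<and> multiple (q * orb x \<epsilon> n - 1)"
proof (rule ccontr)
  assume no: "\<not> ?thesis"
  \<comment> \<open>\<open>R\<close> consists of the descendants of \<open>x\<close>.\<close>
  define R where "R = {orb x \<epsilon> n | \<epsilon> n. \<epsilon> \<in> q_expansions q x}"
  define D where "D = R \<union> (\<lambda>y. top_end - y) ` R"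
  have R_range: "y \<in> {0..top_end}" if "y \<in> R" for y
    using that expansion_iff_orb by (auto simp: R_def)
  have R_child: "q * y - real d \<in> R" if "y \<in> R" "d \<in> {0, 1}" "q * y - real d \<in> {0..top_end}" for y d
  proof -
    from that(1) obtain \<epsilon> n where y: "y = orb x \<epsilon> n" "\<epsilon> \<in> q_expansions q x"
      by (auto simp: R_def)
    from expansion_exists[OF that(3)]
    obtain \<eta> where \<eta>: "\<eta> \<in> q_expansions q (q * y - real d)" by blast
    have "case_nat d \<eta> \<in> q_expansions q (orb x \<epsilon> n)"
      using that(2) y \<eta> by (simp add: expansion_Cons)
    then obtain \<zeta> where z: "\<zeta> \<in> q_expansions q x" "\<forall>i<n. \<zeta> i = \<epsilon> i" "\<forall>i. \<zeta> (n + i) = case_nat d \<eta> i"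
      using expansion_splice[OF y(2)] by blast
    have "orb x \<zeta> n = y" using z(2) unfolding y by (intro orb_cong) auto
    moreover have "\<zeta> n = d" using z(3)[rule_format, of 0] by simp
    ultimately have "orb x \<zeta> (Suc n) = q * y - real d" by simp
    then have "q * y - real d = orb x \<zeta> (Suc n)" by (rule sym)
    then show ?thesis using z(1) unfolding R_def by blast
  qed
  have R_switch: "simple (q * y) \<or> simple (q * y - 1)" if "y \<in> R" "y \<in> switch" for y
  proof -
    from that(1) obtain \<epsilon> n where y: "y = orb x \<epsilon> n" "\<epsilon> \<in> q_expansions q x"
      by (auto simp: R_def)
    then have "\<not> multiple (q * y) \<or> \<not> multiple (q * y - 1)" using no by blast
    then show ?thesis using that(2) by (simp add: switch_children simple_def)
  qed
  have refl: "q * (top_end - y) - real d = top_end - (q * y - real (1 - d))" if "d \<in> {0, 1}" for y d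
    using that top_end_fixed by (auto simp: right_diff_distrib)
  interpret unsplit q D
  proof
    show "y \<in> {0..top_end}" if "y \<in> D" for y
      using that R_range by (force simp: D_def)
    show "top_end - y \<in> D" if "y \<in> D" for y
      using that by (auto simp: D_def)
    show "q * y - real d \<in> D" if "y \<in> D" "d \<in> {0, 1}" "q * y - real d \<in> {0..top_end}" for y d
      using that(1) unfolding D_def
    proof
      assume "y \<in> R"
      then show "q * y - real d \<in> R \<union> (\<lambda>y. top_end - y) ` R" using R_child that by blast
    next
      assume "y \<in> (\<lambda>y. top_end - y) ` R"
      then obtain z where z: "z \<in> R" "y = top_end - z" by blast
      have "q * z - real (1 - d) \<in> {0..top_end}" using that(3) unfolding z refl[OF that(2)] by auto
      then have "q * z - real (1 - d) \<in> R" using R_child[OF z(1), of "1 - d"] that(2) by auto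
      then show "q * y - real d \<in> R \<union> (\<lambda>y. top_end - y) ` R"
        unfolding z(2) refl[OF that(2)] by blast
    qed
    show "simple (q * y) \<or> simple (q * y - 1)" if "y \<in> D" "y \<in> switch" for y
      using that(1) unfolding D_def
    proof
      assume "y \<in> R"
      then show ?thesis using R_switch that by blast
    next
      assume "y \<in> (\<lambda>y. top_end - y) ` R"
      then obtain z where z: "z \<in> R" "y = top_end - z" by blast
      have r: "q * y = top_end - (q * z - 1)" "q * y - 1 = top_end - q * z"
        using refl[of 0 z] refl[of 1 z] z(2) by auto
      have "z \<in> switch" using that(2) unfolding switch_children r by auto
      then show ?thesis
        using R_switch[OF z(1)] simple_reflect[of "q * z"] simple_reflect[of "q * z - 1"]
        unfolding r(2) unfolding r(1) by blast
    qed
  qed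
  obtain \<epsilon> n where "\<epsilon> \<in> q_expansions q x" "orb x \<epsilon> n \<in> switch"
    using multiple_imp_switch[OF assms] by blast
  then show False using D_avoids_switch by (auto simp: D_def R_def)
qed

lemma not_B_aleph0: "q \<notin> B_aleph0"
proof
  assume "q \<in> B_aleph0"
  then obtain x f where f: "bij_betw f (q_expansions q x) (UNIV :: nat set)"
    by (auto simp: B_aleph0_def eqpoll_def)
  then have c: "countable (q_expansions q x)" and "infinite (q_expansions q x)"
    using bij_betw_finite[OF f] by (auto simp: countable_def bij_betw_def)
  have "multiple x"
  proof (rule ccontr)
    assume "\<not> multiple x"
    then have "q_expansions q x \<subseteq> {\<epsilon>}" if "\<epsilon> \<in> q_expansions q x" for \<epsilon>
      using that unfolding multiple_def by blast
    then have "finite (q_expansions q x)"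
      by (metis finite.emptyI finite_insert finite_subset equals0I)
    with \<open>infinite _\<close> show False by blast
  qed
  then show False using uncountable_if_splitting multiple_splits c by blast
qed

end

section \<open>The root of the sextic\<close>

text \<open>
  Elements that are not of the form \<open>\<Phi>\<^sup>n a\<close> have preimages of the same kind under every power of \<open>\<Phi>\<close>.
  As \<open>\<Phi>\<close> prolongs the agreement of two sequences, there is at most one of them.
\<close>
lemma countable_if_prefixed_copy:
  fixes A :: "(nat \<Rightarrow> 'a) set"
  assumes cover: "A \<subseteq> insert a (\<Phi> ` A)"
    and longer: "\<And>\<epsilon> \<eta> n. (\<And>i. i < n \<Longrightarrow> \<epsilon> i = \<eta> i) \<Longrightarrow> (\<And>i. i < Suc n \<Longrightarrow> \<Phi> \<epsilon> i = \<Phi> \<eta> i)"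
  shows "countable A"
proof -
  define L where "L = A - range (\<lambda>n. (\<Phi> ^^ n) a)"
  have L: "L \<subseteq> \<Phi> ` L"
  proof
    fix \<epsilon> assume "\<epsilon> \<in> L"
    then have "\<epsilon> \<in> A" "\<epsilon> \<noteq> (\<Phi> ^^ 0) a" "\<And>n. \<epsilon> \<noteq> (\<Phi> ^^ Suc n) a"
      unfolding L_def by blast+
    then obtain \<eta> where "\<eta> \<in> A" "\<epsilon> = \<Phi> \<eta>" using cover by auto
    moreover have "\<eta> \<notin> range (\<lambda>n. (\<Phi> ^^ n) a)"
      using \<open>\<epsilon> = \<Phi> \<eta>\<close> \<open>\<And>n. \<epsilon> \<noteq> (\<Phi> ^^ Suc n) a\<close> by auto
    ultimately show "\<epsilon> \<in> \<Phi> ` L" by (auto simp: L_def)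
  qed
  have "\<epsilon> i = \<eta> i" if "\<epsilon> \<in> L" "\<eta> \<in> L" "i < n" for \<epsilon> \<eta> i n
    using that
  proof (induction n arbitrary: \<epsilon> \<eta> i)
    case (Suc n)
    obtain \<epsilon>' \<eta>' where "\<epsilon> = \<Phi> \<epsilon>'" "\<eta> = \<Phi> \<eta>'" "\<epsilon>' \<in> L" "\<eta>' \<in> L"
      using Suc.prems L by blast
    then show ?case using longer[of n \<epsilon>' \<eta>' i] Suc by blast
  qed simp
  then have "\<epsilon> = \<eta>" if "\<epsilon> \<in> L" "\<eta> \<in> L" for \<epsilon> \<eta>
    using that by blast
  then have "L = {} \<or> (\<exists>\<epsilon>. L = {\<epsilon>})" by blast
  then have "finite L" by auto
  have "countable (L \<union> range (\<lambda>n. (\<Phi> ^^ n) a))"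
    using \<open>finite L\<close> by (intro countable_Un countable_image) (auto intro: countable_finite)
  then show ?thesis
    by (rule countable_subset[rotated]) (auto simp: L_def)
qed

locale sextic_root = above_golden +
  assumes sextic: "q ^ 6 = q ^ 4 + q ^ 3 + 2 * q\<^sup>2 + q + 1"
begin

text \<open>
  This is the sibling of \<open>t/(q\<^sup>2-1)\<close> for the parameter \<open>t = q\<^sup>-\<^sup>3\<close>, for which the exceptional equation
  \<open>q\<^sup>2 t + t = 1 + q\<^sup>2 + q\<^sup>3 - q\<^sup>4\<close> holds at the root.
\<close>
definition hub :: real where
  "hub = 1 + (1 / q) ^ 3 / (q\<^sup>2 - 1)"

text \<open>
  Both equations express the same relation, which after multiplication by \<open>q\<^sup>3 (q\<^sup>2-1)\<close> is the sextic
  times \<open>q - 1\<close>.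
\<close>
lemma hub_successors:
  "q * (q * hub - 1) = top_end - (1 / q) ^ 4 * (q / (q\<^sup>2 - 1))"
  "q * (q * hub - 1) - 1 = top_end - hub"
proof -
  define d where "d = q\<^sup>2 - 1"
  have d: "0 < d" using q2_pos by (simp add: d_def)
  have te: "top_end * d = q + 1" using top_end_scaled by (simp add: d_def)
  have h: "hub * d = d + (1 / q) ^ 3" using d by (simp add: hub_def d_def[symmetric] field_simps)
  have p: "(1 / q) ^ 4 * (q / d) = (1 / q) ^ 3 / d"
    using q_gt_1 by (simp add: eval_nat_numeral)
  have inv: "q ^ 3 * (1 / q) ^ 3 = 1"
    using q_gt_1 by (simp flip: power_mult_distrib)
  have "q ^ 3 * (q\<^sup>2 * (d + (1 / q) ^ 3) - q * d - (q + 1) + (1 / q) ^ 3)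
      = q ^ 3 * (q\<^sup>2 * d - q * d - (q + 1)) + (q\<^sup>2 + 1) * (q ^ 3 * (1 / q) ^ 3)"
    by (simp only: distrib_left distrib_right right_diff_distrib mult.commute mult.left_commute mult_1)
  also have "\<dots> = (q - 1) * (q ^ 6 - (q ^ 4 + q ^ 3 + 2 * q\<^sup>2 + q + 1))"
    unfolding inv d_def by (simp add: eval_nat_numeral algebra_simps)
  finally have "q\<^sup>2 * (d + (1 / q) ^ 3) - q * d - (q + 1) + (1 / q) ^ 3 = 0"
    using sextic q_gt_1 by simp
  then have "(q * (q * hub - 1)) * d = (top_end - (1 / q) ^ 3 / d) * d"
    using d unfolding left_diff_distrib te
    by (simp add: right_diff_distrib left_diff_distrib mult.assoc h power2_eq_square)
  then show 1: "q * (q * hub - 1) = top_end - (1 / q) ^ 4 * (q / (q\<^sup>2 - 1))"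
    using d p unfolding d_def by simp
  show "q * (q * hub - 1) - 1 = top_end - hub"
    unfolding 1 using p by (simp add: hub_def d_def)
qed

lemma hub_range: "1 < hub" "hub < top_end"
proof -
  show "1 < hub" using q2_pos q_gt_1 by (simp add: hub_def)
  have q_lo: "8 / 5 < q" and q_hi: "q < 33 / 20"
    using q_bounds sextic by auto
  have "(1 / q) ^ 3 \<le> (1 / q) ^ 1" using q_gt_1 by (intro power_decreasing) auto
  also have "\<dots> < 4 / 5" using q_lo by (simp add: field_simps)
  also have "4 / 5 < 2 + q - q\<^sup>2"
  proof -
    have "q * (q - 1) \<le> 33 / 20 * (13 / 20)" using q_hi q_gt_1 by (intro mult_mono) auto
    then show ?thesis by (simp add: power2_eq_square right_diff_distrib)
  qed
  also have "\<dots> = (top_end - 1) * (q\<^sup>2 - 1)"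
    using q_gt_1 by (simp add: top_end_def field_simps power2_eq_square)
  finally have "(1 / q) ^ 3 / (q\<^sup>2 - 1) < top_end - 1"
    using q2_pos by (simp add: pos_divide_less_eq)
  then show "hub < top_end" by (simp add: hub_def)
qed

text \<open>
  The first digit must be \<open>1\<close>. If the second is \<open>0\<close>, the orbit reaches the reflection of a point of
  \<open>period_2_unique\<close>; if it is \<open>1\<close>, it reaches the reflection of \<open>hub\<close>.
\<close>
lemma hub_expansions:
  obtains u where
   "q_expansions q hub = insert (case_nat 1 (case_nat 0 u))
      ((\<lambda>\<epsilon>. case_nat 1 (case_nat 1 (\<lambda>i. 1 - \<epsilon> i))) ` q_expansions q hub)"
proof -
  let ?\<Phi> = "\<lambda>\<epsilon>. case_nat 1 (case_nat 1 (\<lambda>i. 1 - \<epsilon> i))"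
  let ?t = "q * (q * hub - 1)"
  have not_multiple: "\<not> multiple ?t"
    using multiple_reflect[of ?t] period_2_unique[of 4] hub_successors(1) by auto
  have "?t \<in> {0..top_end}"
  proof -
    have "0 \<le> (1 / q) ^ 4 * (q / (q\<^sup>2 - 1))" using q_gt_1 q2_pos by simp
    then show ?thesis using hub_successors hub_range by simp
  qed
  then obtain u where u: "u \<in> q_expansions q ?t" using expansion_exists by blast
  have only_u: "\<epsilon> = u" if "\<epsilon> \<in> q_expansions q ?t" for \<epsilon>
    using u that not_multiple unfolding multiple_def by blast
  have top_lt: "top_end < q * hub"
  proof -
    have "1 < q * (q - 1)" using golden_less by (simp add: power2_eq_square right_diff_distrib)
    then have "top_end < q" using q_gt_1 by (simp add: top_end_def field_simps)
    also have "q * 1 < q * hub" using hub_range(1) q_gt_1 by (intro mult_strict_left_mono) auto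
    finally show ?thesis by simp
  qed
  have "q_expansions q hub \<subseteq> insert (case_nat 1 (case_nat 0 u)) (?\<Phi> ` q_expansions q hub)"
  proof
    fix \<epsilon> assume \<epsilon>: "\<epsilon> \<in> q_expansions q hub"
    obtain d \<eta> where 1: "\<epsilon> = case_nat d \<eta>" "d \<in> {0, 1}" "\<eta> \<in> q_expansions q (q * hub - real d)"
      using \<epsilon> by (rule expansion_cases)
    have d: "d = 1" using 1(2) expansion_range[OF 1(3)] top_lt by auto
    obtain d' \<zeta> where 2: "\<eta> = case_nat d' \<zeta>" "d' \<in> {0, 1}" "\<zeta> \<in> q_expansions q (q * (q * hub - real d) - real d')"
      using 1(3) by (rule expansion_cases)
    show "\<epsilon> \<in> insert (case_nat 1 (case_nat 0 u)) (?\<Phi> ` q_expansions q hub)"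
    proof (cases "d' = 0")
      case True
      then have "\<zeta> = u" using 2(3) d only_u by simp
      then show ?thesis using True 1 2 d by simp
    next
      case False
      then have d': "d' = 1" using 2(2) by simp
      then have \<zeta>: "\<zeta> \<in> q_expansions q (top_end - hub)"
        using 2(3) d hub_successors(2) by simp
      have "1 - (1 - \<zeta> i) = \<zeta> i" for i
      proof -
        have "\<zeta> i \<in> {0, 1}" using \<zeta> unfolding expansion_iff_orb by blast
        then show ?thesis by auto
      qed
      then have "\<epsilon> = ?\<Phi> (\<lambda>i. 1 - \<zeta> i)" using 1(1) 2(1) d d' by (simp del: One_nat_def)
      moreover have "(\<lambda>i. 1 - \<zeta> i) \<in> q_expansions q hub"
        using expansion_complement[OF \<zeta>] by simp
      ultimately show ?thesis by (intro insertI2 image_eqI)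
    qed
  qed
  moreover have "case_nat 1 (case_nat 0 u) \<in> q_expansions q hub"
    using u by (simp add: expansion_Cons)
  moreover have "?\<Phi> \<epsilon> \<in> q_expansions q hub" if "\<epsilon> \<in> q_expansions q hub" for \<epsilon>
    using expansion_complement[OF that] hub_successors(2) by (simp add: expansion_Cons)
  ultimately show thesis using that[of u] by blast
qed

lemma in_B_aleph0: "q \<in> B_aleph0"
proof -
  define \<Phi> :: "(nat \<Rightarrow> nat) \<Rightarrow> nat \<Rightarrow> nat"
    where "\<Phi> \<epsilon> = case_nat 1 (case_nat 1 (\<lambda>i. 1 - \<epsilon> i))" for \<epsilon>
  define A where "A = q_expansions q hub"
  obtain u where "A = insert (case_nat 1 (case_nat 0 u)) (\<Phi> ` A)"
    using hub_expansions unfolding A_def \<Phi>_def by blast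
  then obtain a :: "nat \<Rightarrow> nat" where A: "A = insert a (\<Phi> ` A)" and a: "a 1 = 0"
    by (rule that) simp
  have "countable A"
  proof (rule countable_if_prefixed_copy)
    show "A \<subseteq> insert a (\<Phi> ` A)" using A by blast
    show "\<Phi> \<epsilon> i = \<Phi> \<eta> i" if "\<And>i. i < n \<Longrightarrow> \<epsilon> i = \<eta> i" "i < Suc n" for \<epsilon> \<eta> n i
      using that by (auto simp: \<Phi>_def split: nat.splits)
  qed
  moreover have "infinite A"
  proof
    assume "finite A"
    moreover have "\<Phi> ` A \<subseteq> A" using A by blast
    moreover have "inj_on \<Phi> A"
    proof (rule inj_onI)
      fix \<epsilon> \<eta> assume *: "\<epsilon> \<in> A" "\<eta> \<in> A" "\<Phi> \<epsilon> = \<Phi> \<eta>"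
      show "\<epsilon> = \<eta>"
      proof
        fix i
        have "\<Phi> \<epsilon> (Suc (Suc i)) = \<Phi> \<eta> (Suc (Suc i))" using *(3) by simp
        moreover have "\<epsilon> i \<in> {0, 1}" "\<eta> i \<in> {0, 1}"
          using *(1,2) unfolding A_def expansion_iff_orb by blast+
        ultimately show "\<epsilon> i = \<eta> i" by (auto simp: \<Phi>_def)
      qed
    qed
    \<comment> \<open>But \<open>a\<close> has second digit \<open>0\<close>, unlike the values of \<open>\<Phi>\<close>.\<close>
    ultimately have "\<Phi> ` A = A" by (rule endo_inj_surj)
    then have "a \<in> \<Phi> ` A" using A by blast
    then show False using a by (auto simp: \<Phi>_def)
  qed
  ultimately have "A \<approx> (UNIV :: nat set)"
    using to_nat_on_infinite unfolding eqpoll_def by blast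
  then show ?thesis
    using q_gt_1 q_lt_2 hub_range unfolding B_aleph0_def A_def top_end_def by force
qed

end

theorem theorem1p2:
  shows "\<exists>q::real.
      {x \<in> {1<..<2}. x ^ 6 = x ^ 4 + x ^ 3 + 2 * x ^ 2 + x + 1} = {q} \<and>
      \<bar>q - 1.64541\<bar> < 0.000005 \<and>
      q \<in> B_aleph0 \<and> q > (1 + sqrt 5) / 2 \<and>
      (\<forall>p \<in> B_aleph0. p > (1 + sqrt 5) / 2 \<longrightarrow> q \<le> p)"
proof -
  let ?F = "\<lambda>x::real. x ^ 6 - (x ^ 4 + x ^ 3 + 2 * x\<^sup>2 + x + 1)"
  have "\<exists>q\<ge>1.645405. q \<le> 1.645415 \<and> ?F q = 0"
    by (rule IVT') (auto simp: eval_nat_numeral intro!: continuous_intros)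
  then obtain q :: real where q: "1.645405 \<le> q" "q \<le> 1.645415"
      "q ^ 6 = q ^ 4 + q ^ 3 + 2 * q\<^sup>2 + q + 1"
    by auto
  have "q \<noteq> 1.645405" "q \<noteq> 1.645415"
    using q(3) by (intro notI; simp add: eval_nat_numeral)+
  then have "1.645405 < q" "q < 1.645415" using q by simp_all
  then have approx: "\<bar>q - 1.64541\<bar> < 0.000005"
    unfolding abs_less_iff by (simp add: field_simps)
  have "x = q" if "1 < x" "x ^ 6 = x ^ 4 + x ^ 3 + 2 * x\<^sup>2 + x + 1" for x
    using sextic_pos_mono[of x q] sextic_pos_mono[of q x] that q by force
  then have root: "{x \<in> {1<..<2}. x ^ 6 = x ^ 4 + x ^ 3 + 2 * x ^ 2 + x + 1} = {q}"
    using q by auto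
  have "sqrt 5 < 2.2362"
    by (rule real_less_lsqrt) (auto simp: power2_eq_square)
  then have golden: "(1 + sqrt 5) / 2 < q" using q by simp
  have square: "p + 1 < p\<^sup>2" if "(1 + sqrt 5) / 2 < p" for p :: real
  proof -
    have "(1 - sqrt 5) / 2 < (1 + sqrt 5) / 2" by (intro divide_strict_right_mono) auto
    then have "(1 - sqrt 5) / 2 < p" using that by (rule less_trans)
    then have "0 < (p - (1 + sqrt 5) / 2) * (p - (1 - sqrt 5) / 2)"
      using that by (intro mult_pos_pos) simp_all
    also have "\<dots> = p\<^sup>2 - p - 1"
      by (simp add: field_simps power2_eq_square)
    finally show ?thesis by simp
  qed
  interpret sextic_root q
    using q square[OF golden] by unfold_locales auto
  have "q \<le> p" if p: "p \<in> B_aleph0" "(1 + sqrt 5) / 2 < p" for p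
  proof (rule ccontr)
    assume "\<not> q \<le> p"
    have "1 < p" "p < 2" using p(1) by (auto simp: B_aleph0_def)
    moreover have "p ^ 6 < p ^ 4 + p ^ 3 + 2 * p\<^sup>2 + p + 1"
      using sextic_pos_mono[of p q] \<open>\<not> q \<le> p\<close> \<open>1 < p\<close> q(3) by force
    ultimately interpret low: gap p
      using square[OF p(2)] by unfold_locales
    show False using low.not_B_aleph0 p(1) by blast
  qed
  then show ?thesis using root approx in_B_aleph0 golden by blast
qed

end
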